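(* Let $\{\mathcal F_d\}_{d\in\mathbb N\cup\{\infty\}}$ be a family of function classes, where each $\mathcal F_d$ consists of functions $\mathcal H_d\to\mathbb R$, let $\epsilon$ be an error metric and let $\bar p\in\mathbb N$. Suppose that this family satisfies the direct-sum assumption (A) and the randomized nonasymptotic lower bound assumption (B) stated in the context, with $\beta:[1,\infty)\to(0,1]$ being the decreasing bijection from (B). Let $\rho:[1,\infty)\to(0,1]$ be a decreasing bijection. Then there exists a sequence of positive integers $n_1,n_2,\dots$ with $\lim_{i\to\infty}n_i=\infty$ such that for any $\delta\in(0,\tfrac12]$ there exists a probability measure $\mathcal D$ on functions in $\mathcal F_\infty$ such that for any $\mathrm A\in\mathcal A_{\mathrm{rand}}^{(\bar p)}$, $$\mathbb P_{\mathrm A,\,F\sim\mathcal D}\Big(\epsilon(x^{(n_i+1)},F)\ge\rho(n_i)\beta(n_i)\ \ \forall i\in\mathbb N\Big)\ge1-2\delta,$$ where $\{x^{(t)}\}_{t=1}^\infty$ is the realization of the iterates $\mathrm A[\xi,F]$, with random seed $\xi$ independent of $F$.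
   Context: $\mathbb N=\{1,2,\dots\}$. For $d\in\mathbb N$, $\mathcal H_d$ is a $d$-dimensional real Hilbert space, and $\mathcal H_\infty$ is an infinite-dimensional real Hilbert space (i.e. $\ell^2$). Given positive integers $\{d_i\}_{i\ge1}$, $\mathcal H_\infty$ is identified with $\bigoplus_{i\ge1}\mathcal H_{d_i}=\{x=(\underline x_i)_{i\ge1}:\underline x_i\in\mathcal H_{d_i},\ \sum_i\|\underline x_i\|^2<\infty\}$ with inner product $\langle x,y\rangle=\sum_i\langle\underline x_i,\underline y_i\rangle$. Oracle: $\nabla^{(0,\dots,\bar p)}f(x)$ denotes the function value and all derivatives of $f$ through order $\bar p$ at $x$ (when $f$ is convex and nondifferentiable, $\nabla f(x)$ denotes an arbitrary fixed selection $\nabla f(x)\in\partial f(x)$). Randomized algorithms: $\mathrm A\in\mathcal A_{\mathrm{rand}}^{(\bar p)}$ (on a Hilbert space $\mathcal H$) if it produces iterates $x^{(t)}=\mathrm A^{(t)}\big(\xi,\nabla^{(0,\dots,\bar p)}f(x^{(1)}),\dots,\nabla^{(0,\dots,\bar p)}f(x^{(t-1)})\big)$, $t\in\mathbb N$, where the $\mathrm A^{(t)}$ are measurable maps into $\mathcal H$ and $\xi\sim\mathsf{Unif}[0,1]$ is drawn independently of $f$; the iterates are denoted $\mathrm A[\xi,f]$. Error metric: $\epsilon(x,f)\ge0$ for every $x$ in the domain of $f$. Assumption (A) (direct sums): there exist a nonnegative integer $q$ and positive real sequences $\{\lambda_i\}_{i\ge1}$, $\{\mu_i\}_{i\ge1}$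 such that for any sequence of positive integers $\{d_i\}_{i\ge1}$ and any functions $f_i\in\mathcal F_{d_i}$, the function $F(x):=\sum_{i=1}^\infty\lambda_if_i(\mu_i\underline x_i)$, $x=(\underline x_i)_{i\ge1}\in\mathcal H_\infty$, belongs to $\mathcal F_\infty$, and for all $i\in\mathbb N$ and all $x\in\mathcal H_\infty$, $\epsilon(x,F)\ge\lambda_i\mu_i^q\,\epsilon(\mu_i\underline x_i,f_i)$. Assumption (B) (randomized nonasymptotic lower bound): the $\bar p$th-order oracle is well defined on every $\mathcal F_d$, $d\in\mathbb N\cup\{\infty\}$, and there exist a decreasing bijection $\beta:[1,\infty)\to(0,1]$ and a constant $C>0$ such that for any $n\in\mathbb N$ and $\delta\in(0,\frac12]$ there exist $d_{n,\delta}\in\mathbb N$ and a probability measure $\mathcal D_{n,\delta}$ on functions in $\mathcal F_{d_{n,\delta}}$ such that for any $\mathrm A\in\mathcal A_{\mathrm{rand}}^{(\bar p)}$, $\mathbb P_{\mathrm A,f\sim\mathcal D_{n,\delta}}\big(\epsilon(x^{(n+1)},f)\ge C\beta(n)\big)\ge1-2\delta$, where $\{x^{(t)}\}$ is the realization of $\mathrm A[\xi,f]$ and $\xi$ is independent of $f$.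
   Formalization: The selection of subgradients is not arbitrary: for nondifferentiable direct sums F the selected subgradient must be the direct sum of those selected for the f_i (otherwise it could encode F); the error metric and the oracle are assumed jointly measurable in (x,f). *)

theory Defs
  imports "HOL-Probability.Probability"
begin

section \<open>The real Hilbert space of square-summable sequences\<close>

typedef ell2 = "{x :: nat \<Rightarrow> real. summable (\<lambda>i. (x i)\<^sup>2)}"
  morphisms coord Abs_ell2
  by (rule exI[of _ "\<lambda>_. 0"]) simp

lemma summable_coord: "summable (\<lambda>i. (coord x i)\<^sup>2)"
  using coord[of x] by simp

lemma ell2_eqI: "(\<And>i. coord x i = coord y i) \<Longrightarrow> x = y"
  by (simp add: coord_inject[symmetric] fun_eq_iff)

lemma summable_mult_of_squares:
  fixes f g :: "nat \<Rightarrow> real"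
  assumes "summable (\<lambda>i. (f i)\<^sup>2)" "summable (\<lambda>i. (g i)\<^sup>2)"
  shows "summable (\<lambda>i. f i * g i)"
proof (rule summable_comparison_test')
  show "summable (\<lambda>i. (f i)\<^sup>2 + (g i)\<^sup>2)"
    using assms by (rule summable_add)
  fix i
  have "0 \<le> (\<bar>f i\<bar> - \<bar>g i\<bar>)\<^sup>2" by simp
  then have "2 * (\<bar>f i\<bar> * \<bar>g i\<bar>) \<le> (f i)\<^sup>2 + (g i)\<^sup>2"
    by (simp add: power2_diff)
  moreover have "0 \<le> \<bar>f i\<bar> * \<bar>g i\<bar>" by simp
  ultimately show "norm (f i * g i) \<le> (f i)\<^sup>2 + (g i)\<^sup>2"
    unfolding real_norm_def abs_mult by linarith
qed

lemma summable_coord_mult: "summable (\<lambda>i. coord x i * coord y i)"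
  by (intro summable_mult_of_squares summable_coord)

lemma summable_add_squares:
  fixes f g :: "nat \<Rightarrow> real"
  assumes "summable (\<lambda>i. (f i)\<^sup>2)" "summable (\<lambda>i. (g i)\<^sup>2)"
  shows "summable (\<lambda>i. (f i + g i)\<^sup>2)"
proof -
  have "summable (\<lambda>i. (f i)\<^sup>2 + (g i)\<^sup>2 + 2 * (f i * g i))"
    by (intro summable_add summable_mult assms summable_mult_of_squares)
  then show ?thesis by (simp add: power2_sum mult.assoc)
qed

instantiation ell2 :: real_vector
begin

definition "0 = Abs_ell2 (\<lambda>_. 0)"
definition "x + y = Abs_ell2 (\<lambda>i. coord x i + coord y i)"
definition "x - y = Abs_ell2 (\<lambda>i. coord x i - coord y i)"
definition "- x = Abs_ell2 (\<lambda>i. - coord x i)"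
definition "r *\<^sub>R x = Abs_ell2 (\<lambda>i. r * coord x i)"

lemma coord_zero [simp]: "coord 0 i = 0"
  by (simp add: zero_ell2_def Abs_ell2_inverse)

lemma coord_add [simp]: "coord (x + y) i = coord x i + coord y i"
  by (simp add: plus_ell2_def Abs_ell2_inverse summable_add_squares summable_coord)

lemma coord_diff [simp]: "coord (x - y) i = coord x i - coord y i"
  using summable_add_squares[of "coord x" "\<lambda>i. - coord y i"]
  by (simp add: minus_ell2_def Abs_ell2_inverse summable_coord)

lemma coord_uminus [simp]: "coord (- x) i = - coord x i"
  by (simp add: uminus_ell2_def Abs_ell2_inverse summable_coord)

lemma coord_scaleR [simp]: "coord (r *\<^sub>R x) i = r * coord x i"
  by (simp add: scaleR_ell2_def Abs_ell2_inverse summable_coord power_mult_distrib summable_mult)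

instance
  by standard (auto intro!: ell2_eqI simp: algebra_simps)

end

instantiation ell2 :: real_inner
begin

definition inner_ell2 :: "ell2 \<Rightarrow> ell2 \<Rightarrow> real"
  where "inner_ell2 x y = (\<Sum>i. coord x i * coord y i)"
definition norm_ell2 :: "ell2 \<Rightarrow> real" where "norm_ell2 x = sqrt (x \<bullet> x)"
definition sgn_ell2 :: "ell2 \<Rightarrow> ell2" where "sgn_ell2 x = x /\<^sub>R norm x"
definition dist_ell2 :: "ell2 \<Rightarrow> ell2 \<Rightarrow> real" where "dist_ell2 x y = norm (x - y)"
definition uniformity_ell2 :: "(ell2 \<times> ell2) filter"
  where "uniformity_ell2 = (INF e\<in>{0<..}. principal {(x, y). dist x y < e})"
definition open_ell2 :: "ell2 set \<Rightarrow> bool"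
  where "open_ell2 U \<longleftrightarrow> (\<forall>x\<in>U. \<forall>\<^sub>F (x', y) in uniformity. x' = x \<longrightarrow> y \<in> U)"

instance
proof
  fix x y z :: ell2 and r :: real
  show "dist x y = norm (x - y)" by (rule dist_ell2_def)
  show "sgn x = x /\<^sub>R norm x" by (rule sgn_ell2_def)
  show "uniformity = (INF e\<in>{0<..}. principal {(x :: ell2, y). dist x y < e})"
    by (rule uniformity_ell2_def)
  show "open U \<longleftrightarrow> (\<forall>x\<in>U. \<forall>\<^sub>F (x', y) in uniformity. x' = x \<longrightarrow> y \<in> U)" for U :: "ell2 set"
    by (rule open_ell2_def)
  show "x \<bullet> y = y \<bullet> x"
    by (simp add: inner_ell2_def mult.commute)
  show "(x + y) \<bullet> z = x \<bullet> z + y \<bullet> z"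
    by (simp add: inner_ell2_def distrib_right suminf_add summable_coord_mult)
  show "(r *\<^sub>R x) \<bullet> y = r * (x \<bullet> y)"
    by (simp add: inner_ell2_def mult.assoc suminf_mult summable_coord_mult)
  show "0 \<le> x \<bullet> x"
    by (simp add: inner_ell2_def suminf_nonneg summable_coord_mult)
  show "x \<bullet> x = 0 \<longleftrightarrow> x = 0"
  proof
    assume "x \<bullet> x = 0"
    then have "\<forall>i. coord x i * coord x i = 0"
      using suminf_eq_zero_iff[OF summable_coord_mult[of x x]] by (simp add: inner_ell2_def)
    then show "x = 0" by (intro ell2_eqI) simp
  qed (simp add: inner_ell2_def)
  show "norm x = sqrt (x \<bullet> x)" by (rule norm_ell2_def)
qed

end

lemma sum_coord_squares_le: "(\<Sum>i<k. (coord x i)\<^sup>2) \<le> (norm x)\<^sup>2"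
  unfolding power2_norm_eq_inner inner_ell2_def
  using sum_le_suminf[OF summable_coord_mult[of x x], of "{..<k}"]
  by (simp add: power2_eq_square)

lemma norm_ell2_le:
  assumes "\<And>k. (\<Sum>i<k. (coord x i)\<^sup>2) \<le> e\<^sup>2" "0 \<le> e"
  shows "norm x \<le> e"
proof -
  have "x \<bullet> x \<le> e\<^sup>2"
    unfolding inner_ell2_def
    by (rule suminf_le_const[OF summable_coord_mult])
      (use assms(1) in \<open>simp add: power2_eq_square\<close>)
  then show ?thesis
    using assms(2) by (simp add: norm_ell2_def real_le_lsqrt)
qed

lemma abs_coord_le_norm: "\<bar>coord x i\<bar> \<le> norm x"
proof -
  have "(coord x i)\<^sup>2 \<le> (\<Sum>j<Suc i. (coord x j)\<^sup>2)"
    by (simp add: sum_nonneg)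
  also have "\<dots> \<le> (norm x)\<^sup>2" by (rule sum_coord_squares_le)
  finally show ?thesis by (simp add: abs_le_square_iff[symmetric])
qed

instance ell2 :: complete_space
proof
  fix X :: "nat \<Rightarrow> ell2"
  assume X: "Cauchy X"
  have "Cauchy (\<lambda>n. coord (X n) i)" for i
  proof (rule metric_CauchyI)
    fix e :: real
    assume "0 < e"
    then obtain M where M: "\<And>m n. m \<ge> M \<Longrightarrow> n \<ge> M \<Longrightarrow> dist (X m) (X n) < e"
      using metric_CauchyD[OF X] by blast
    have "dist (coord (X m) i) (coord (X n) i) \<le> dist (X m) (X n)" for m n
      using abs_coord_le_norm[of "X m - X n" i] by (simp add: dist_norm)
    then show "\<exists>M. \<forall>m\<ge>M. \<forall>n\<ge>M. dist (coord (X m) i) (coord (X n) i) < e"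
      using M by (meson le_less_trans)
  qed
  then have "convergent (\<lambda>n. coord (X n) i)" for i
    by (rule Cauchy_convergent)
  then have y: "(\<lambda>n. coord (X n) i) \<longlonglongrightarrow> lim (\<lambda>n. coord (X n) i)" for i
    by (simp only: convergent_LIMSEQ_iff)
  define y where "y i = lim (\<lambda>n. coord (X n) i)" for i
  note y = y[folded y_def]
  have tail: "\<exists>M. \<forall>m\<ge>M. \<forall>k. (\<Sum>i<k. (coord (X m) i - y i)\<^sup>2) \<le> e\<^sup>2" if e: "0 < e" for e :: real
  proof -
    obtain M where M: "\<And>m n. m \<ge> M \<Longrightarrow> n \<ge> M \<Longrightarrow> dist (X m) (X n) < e"
      using metric_CauchyD[OF X e] by blast
    have "(\<Sum>i<k. (coord (X m) i - y i)\<^sup>2) \<le> e\<^sup>2" if m: "m \<ge> M" for m k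
    proof (rule LIMSEQ_le_const2)
      show "(\<lambda>n. \<Sum>i<k. (coord (X m) i - coord (X n) i)\<^sup>2)
          \<longlonglongrightarrow> (\<Sum>i<k. (coord (X m) i - y i)\<^sup>2)"
        by (intro tendsto_intros y)
      have "(\<Sum>i<k. (coord (X m) i - coord (X n) i)\<^sup>2) \<le> e\<^sup>2" if "n \<ge> M" for n
      proof -
        have "(\<Sum>i<k. (coord (X m) i - coord (X n) i)\<^sup>2) \<le> (norm (X m - X n))\<^sup>2"
          using sum_coord_squares_le[where x = "X m - X n"] by simp
        also have "\<dots> \<le> e\<^sup>2"
          using M[OF m that] by (intro power_mono) (auto simp: dist_norm)
        finally show ?thesis .
      qed
      then show "\<exists>N. \<forall>n\<ge>N. (\<Sum>i<k. (coord (X m) i - coord (X n) i)\<^sup>2) \<le> e\<^sup>2" by blast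
    qed
    then show ?thesis by blast
  qed
  obtain M where M: "(\<Sum>i<k. (coord (X M) i - y i)\<^sup>2) \<le> 1\<^sup>2" for k
    using tail[of 1] zero_less_one by blast
  have "summable (\<lambda>i. (coord (X M) i - y i)\<^sup>2)"
    by (rule summableI_nonneg_bounded[OF _ M]) simp
  then have "summable (\<lambda>i. (y i - coord (X M) i)\<^sup>2)"
    by (simp add: power2_commute)
  from summable_add_squares[OF this summable_coord[of "X M"]]
  have coord_y: "coord (Abs_ell2 y) = y"
    by (simp add: Abs_ell2_inverse)
  have "X \<longlonglongrightarrow> Abs_ell2 y"
  proof (rule metric_LIMSEQ_I)
    fix r :: real
    assume "0 < r"
    then obtain N where "\<And>m k. m \<ge> N \<Longrightarrow> (\<Sum>i<k. (coord (X m) i - y i)\<^sup>2) \<le> (r / 2)\<^sup>2"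
      using tail[of "r / 2"] half_gt_zero by blast
    then have "norm (X m - Abs_ell2 y) \<le> r / 2" if "m \<ge> N" for m
      using that \<open>0 < r\<close> by (intro norm_ell2_le) (auto simp: coord_y)
    then show "\<exists>N. \<forall>m\<ge>N. dist (X m) (Abs_ell2 y) < r"
      using \<open>0 < r\<close> by (intro exI[of _ N]) (force simp: dist_norm)
  qed
  then show "convergent X" by (rule convergentI)
qed

text \<open>The \<open>d\<close>-dimensional Hilbert space is realized as the span of the first \<open>d\<close> coordinate
  directions, so that all dimensions \<open>d :: enat\<close> live in one type and \<open>hilb \<infinity> = UNIV\<close>.\<close>

definition hilb :: "enat \<Rightarrow> ell2 set"
  where "hilb d = {x. \<forall>i. d \<le> enat i \<longrightarrow> coord x i = 0}"

text \<open>The orthogonal decomposition of \<open>hilb \<infinity>\<close> into summands of dimensions \<open>ds 0, ds 1, \<dots>\<close>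
  takes consecutive runs of coordinates; \<open>block ds i x\<close> is the \<open>i\<close>-th component of \<open>x\<close>,
  as an element of \<open>hilb (ds i)\<close>.\<close>

definition block :: "(nat \<Rightarrow> nat) \<Rightarrow> nat \<Rightarrow> ell2 \<Rightarrow> ell2"
  where "block ds i x = Abs_ell2 (\<lambda>k. if k < ds i then coord x ((\<Sum>j<i. ds j) + k) else 0)"

lemma hilb_infinity: "hilb \<infinity> = UNIV"
  by (simp add: hilb_def)

lemma coord_block:
  "coord (block ds i x) k = (if k < ds i then coord x ((\<Sum>j<i. ds j) + k) else 0)"
proof -
  have "summable (\<lambda>k. (if k < ds i then coord x ((\<Sum>j<i. ds j) + k) else 0)\<^sup>2)"
    by (rule summable_finite[of "{..<ds i}"]) auto
  then show ?thesis by (simp add: block_def Abs_ell2_inverse)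
qed

lemma block_in_hilb: "block ds i x \<in> hilb (enat (ds i))"
  by (simp add: hilb_def coord_block)


section \<open>Derivatives and oracles\<close>

text \<open>A jet at a point is a function on lists of directions: its value at a list of length
  \<open>k\<close> is the \<open>k\<close>-th derivative, a bounded \<open>k\<close>-linear form, applied to these directions.
  In particular its value at \<open>[]\<close> is the function value.\<close>

definition bounded_multilinear_form :: "enat \<Rightarrow> nat \<Rightarrow> (ell2 list \<Rightarrow> real) \<Rightarrow> bool"
  where "bounded_multilinear_form d k T \<longleftrightarrow>
    (\<forall>hs j u v a b. set hs \<subseteq> hilb d \<and> length hs = k \<and> j < k \<and> u \<in> hilb d \<and> v \<in> hilb d \<longrightarrow>
      T (hs[j := a *\<^sub>R u + b *\<^sub>R v]) = a * T (hs[j := u]) + b * T (hs[j := v])) \<and>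
    (\<exists>c. \<forall>hs. set hs \<subseteq> hilb d \<and> length hs = k \<longrightarrow> \<bar>T hs\<bar> \<le> c * prod_list (map norm hs))"

text \<open>\<open>D x\<close> is the jet of order \<open>p\<close> of \<open>f\<close> at every \<open>x \<in> hilb d\<close>, the derivatives being
  iterated Frechet derivatives with respect to the operator norm.\<close>

definition has_derivatives ::
    "enat \<Rightarrow> nat \<Rightarrow> (ell2 \<Rightarrow> real) \<Rightarrow> (ell2 \<Rightarrow> ell2 list \<Rightarrow> real) \<Rightarrow> bool"
  where "has_derivatives d p f D \<longleftrightarrow>
    (\<forall>x\<in>hilb d. D x [] = f x) \<and>
    (\<forall>x\<in>hilb d. \<forall>k\<le>p. bounded_multilinear_form d k (D x)) \<and>
    (\<forall>x\<in>hilb d. \<forall>k<p. \<forall>e>0. \<exists>r>0. \<forall>y\<in>hilb d. norm (y - x) < r \<longrightarrow>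
      (\<forall>hs. set hs \<subseteq> hilb d \<and> length hs = k \<longrightarrow>
        \<bar>D y hs - D x hs - D x ((y - x) # hs)\<bar> \<le> e * norm (y - x) * prod_list (map norm hs)))"

definition times_differentiable :: "enat \<Rightarrow> nat \<Rightarrow> (ell2 \<Rightarrow> real) \<Rightarrow> bool"
  where "times_differentiable d p f \<longleftrightarrow> (\<exists>D. has_derivatives d p f D)"

definition subdifferential :: "enat \<Rightarrow> (ell2 \<Rightarrow> real) \<Rightarrow> ell2 \<Rightarrow> ell2 set"
  where "subdifferential d f x = {g \<in> hilb d. \<forall>y\<in>hilb d. f y \<ge> f x + g \<bullet> (y - x)}"

definition directions :: "nat \<Rightarrow> enat \<Rightarrow> ell2 list set"
  where "directions p d = {hs. set hs \<subseteq> hilb d \<and> length hs \<le> p}"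

text \<open>\<open>orc x\<close> is the answer of the oracle of order \<open>p\<close> for \<open>f\<close> at \<open>x\<close>. In the second case the
  gradient is a selection from the subdifferential, which at points of differentiability
  can only be the gradient.\<close>

definition is_oracle ::
    "enat \<Rightarrow> nat \<Rightarrow> (ell2 \<Rightarrow> real) \<Rightarrow> (ell2 \<Rightarrow> ell2 list \<Rightarrow> real) \<Rightarrow> bool"
  where "is_oracle d p f orc \<longleftrightarrow>
    (\<exists>D. has_derivatives d p f D \<and> (\<forall>x\<in>hilb d. orc x = restrict (D x) (directions p d))) \<or>
    (p = 1 \<and> convex_on (hilb d) f \<and>
      (\<forall>x\<in>hilb d. \<exists>g\<in>subdifferential d f x.
        orc x = (\<lambda>hs\<in>directions p d. if hs = [] then f x else g \<bullet> hd hs)))"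


section \<open>Measurable structures\<close>

definition point_space :: "enat \<Rightarrow> ell2 measure"
  where "point_space d = restrict_space borel (hilb d)"

text \<open>Jets and functions carry the sigma-algebras generated by the evaluation maps.\<close>

definition jet_space :: "nat \<Rightarrow> enat \<Rightarrow> (ell2 list \<Rightarrow> real) measure"
  where "jet_space p d =
    restrict_space (Pi\<^sub>M (directions p d) (\<lambda>_. borel)) {T. \<forall>k\<le>p. bounded_multilinear_form d k T}"

definition fun_space :: "enat \<Rightarrow> (ell2 \<Rightarrow> real) set \<Rightarrow> (ell2 \<Rightarrow> real) measure"
  where "fun_space d S = restrict_space (Pi\<^sub>M (hilb d) (\<lambda>_. borel)) S"

definition random_function :: "enat \<Rightarrow> (ell2 \<Rightarrow> real) set \<Rightarrow> (ell2 \<Rightarrow> real) measure \<Rightarrow> bool"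
  where "random_function d S D \<longleftrightarrow> prob_space D \<and> sets D = sets (fun_space d S)"

definition unif01 :: "real measure"
  where "unif01 = restrict_space lborel {0..1}"


section \<open>Function classes, oracles and error metrics\<close>

text \<open>The classes are indexed by dimensions \<open>d \<ge> 1\<close>; index \<open>0\<close> is ignored throughout. The error
  metric takes \<open>d\<close> as an argument since an extensional function does not determine its domain.\<close>

definition function_classes :: "(enat \<Rightarrow> (ell2 \<Rightarrow> real) set) \<Rightarrow> bool"
  where "function_classes Fc \<longleftrightarrow> (\<forall>d\<ge>1. Fc d \<subseteq> hilb d \<rightarrow>\<^sub>E UNIV)"

text \<open>Joint measurability of the error metric, and of the oracle below, is what makes the
  probabilities of the events considered later meaningful.\<close>

definition error_metric ::
    "(enat \<Rightarrow> (ell2 \<Rightarrow> real) set) \<Rightarrow> (enat \<Rightarrow> ell2 \<Rightarrow> (ell2 \<Rightarrow> real) \<Rightarrow> real) \<Rightarrow> bool"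
  where "error_metric Fc eps \<longleftrightarrow> (\<forall>d\<ge>1.
    (\<forall>f\<in>Fc d. \<forall>x\<in>hilb d. 0 \<le> eps d x f) \<and>
    (\<lambda>(x, f). eps d x f) \<in> borel_measurable (point_space d \<Otimes>\<^sub>M fun_space d (Fc d)))"

definition oracle_well_defined ::
    "nat \<Rightarrow> (enat \<Rightarrow> (ell2 \<Rightarrow> real) set) \<Rightarrow>
     (enat \<Rightarrow> (ell2 \<Rightarrow> real) \<Rightarrow> ell2 \<Rightarrow> ell2 list \<Rightarrow> real) \<Rightarrow> bool"
  where "oracle_well_defined p Fc orc \<longleftrightarrow> (\<forall>d\<ge>1.
    (\<forall>f\<in>Fc d. is_oracle d p f (orc d f)) \<and>
    (\<lambda>(x, f). orc d f x) \<in> measurable (point_space d \<Otimes>\<^sub>M fun_space d (Fc d)) (jet_space p d))"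


section \<open>Direct sums\<close>

definition direct_sum ::
    "(nat \<Rightarrow> real) \<Rightarrow> (nat \<Rightarrow> real) \<Rightarrow> (nat \<Rightarrow> nat) \<Rightarrow> (nat \<Rightarrow> ell2 \<Rightarrow> real) \<Rightarrow> ell2 \<Rightarrow> real"
  where "direct_sum lam mu ds fs x = (\<Sum>i. lam i * fs i (mu i *\<^sub>R block ds i x))"

definition direct_sum_property ::
    "(enat \<Rightarrow> (ell2 \<Rightarrow> real) set) \<Rightarrow> (enat \<Rightarrow> ell2 \<Rightarrow> (ell2 \<Rightarrow> real) \<Rightarrow> real) \<Rightarrow>
     nat \<Rightarrow> (nat \<Rightarrow> real) \<Rightarrow> (nat \<Rightarrow> real) \<Rightarrow> bool"
  where "direct_sum_property Fc eps q lam mu \<longleftrightarrow>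
    (\<forall>i. 0 < lam i) \<and> (\<forall>i. 0 < mu i) \<and>
    (\<forall>ds fs. (\<forall>i. 1 \<le> ds i) \<and> (\<forall>i. fs i \<in> Fc (enat (ds i))) \<longrightarrow>
      (\<forall>x. summable (\<lambda>i. lam i * fs i (mu i *\<^sub>R block ds i x))) \<and>
      direct_sum lam mu ds fs \<in> Fc \<infinity> \<and>
      (\<forall>i x. eps \<infinity> x (direct_sum lam mu ds fs)
        \<ge> lam i * mu i ^ q * eps (enat (ds i)) (mu i *\<^sub>R block ds i x) (fs i)))"

text \<open>Where a direct sum is differentiable its gradient is determined by the summands; otherwise
  the convention fixing the subgradient has to be consistent with this. (The subgradient of
  minimal norm is such a convention.)\<close>

definition selection_respects_sums ::
    "nat \<Rightarrow> (enat \<Rightarrow> (ell2 \<Rightarrow> real) set) \<Rightarrow>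
     (enat \<Rightarrow> (ell2 \<Rightarrow> real) \<Rightarrow> ell2 \<Rightarrow> ell2 list \<Rightarrow> real) \<Rightarrow>
     (nat \<Rightarrow> real) \<Rightarrow> (nat \<Rightarrow> real) \<Rightarrow> bool"
  where "selection_respects_sums p Fc orc lam mu \<longleftrightarrow>
    (\<forall>ds fs. (\<forall>i. 1 \<le> ds i) \<and> (\<forall>i. fs i \<in> Fc (enat (ds i))) \<and>
        \<not> times_differentiable \<infinity> p (direct_sum lam mu ds fs) \<longrightarrow>
      (\<forall>x h. (\<lambda>i. lam i * mu i * orc (enat (ds i)) (fs i) (mu i *\<^sub>R block ds i x) [block ds i h])
        sums orc \<infinity> (direct_sum lam mu ds fs) x [h]))"


section \<open>Randomized algorithms\<close>

text \<open>Iterates are numbered from \<open>1\<close>; the \<open>t\<close>-th one depends on the seed and on the answers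
  numbered \<open>1, \<dots>, t - 1\<close>.\<close>

type_synonym algorithm = "nat \<Rightarrow> real \<times> (nat \<Rightarrow> ell2 list \<Rightarrow> real) \<Rightarrow> ell2"

definition rand_algorithm :: "nat \<Rightarrow> enat \<Rightarrow> algorithm \<Rightarrow> bool"
  where "rand_algorithm p d A \<longleftrightarrow>
    (\<forall>t\<ge>1. A t \<in> measurable (unif01 \<Otimes>\<^sub>M Pi\<^sub>M {1..<t} (\<lambda>_. jet_space p d)) (point_space d))"

function iterate :: "algorithm \<Rightarrow> (ell2 \<Rightarrow> ell2 list \<Rightarrow> real) \<Rightarrow> real \<Rightarrow> nat \<Rightarrow> ell2"
  where "iterate A orc xi t =
    A t (xi, \<lambda>s. if s \<in> {1..<t} then orc (iterate A orc xi s) else undefined)"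
  by auto
termination by (relation "Wellfounded.measure (\<lambda>(_, _, _, t). t)") auto

declare iterate.simps [simp del]

definition randomized_lower_bound ::
    "nat \<Rightarrow> (enat \<Rightarrow> (ell2 \<Rightarrow> real) set) \<Rightarrow> (enat \<Rightarrow> ell2 \<Rightarrow> (ell2 \<Rightarrow> real) \<Rightarrow> real) \<Rightarrow>
     (enat \<Rightarrow> (ell2 \<Rightarrow> real) \<Rightarrow> ell2 \<Rightarrow> ell2 list \<Rightarrow> real) \<Rightarrow> (real \<Rightarrow> real) \<Rightarrow> bool"
  where "randomized_lower_bound p Fc eps orc \<beta> \<longleftrightarrow>
    (\<exists>C>0. \<forall>n\<ge>1. \<forall>\<delta>. 0 < \<delta> \<and> \<delta> \<le> 1 / 2 \<longrightarrow>
      (\<exists>d\<ge>1. \<exists>D. random_function (enat d) (Fc (enat d)) D \<and>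
        (\<forall>A. rand_algorithm p (enat d) A \<longrightarrow>
          \<P>((xi, f) in unif01 \<Otimes>\<^sub>M D.
            eps (enat d) (iterate A (orc (enat d) f) xi (n + 1)) f \<ge> C * \<beta> (real n))
          \<ge> 1 - 2 * \<delta>)))"

definition decreasing_bijection :: "(real \<Rightarrow> real) \<Rightarrow> bool"
  where "decreasing_bijection r \<longleftrightarrow> antimono_on {1..} r \<and> bij_betw r {1..} {0<..1}"

end

theory Submission
  imports Defs
begin

text \<open>
  Choose \<open>n i \<ge> i + 1\<close> with \<open>\<rho> (n i) \<le> C \<lambda>\<^sub>i \<mu>\<^sub>i^q\<close>, draw hard functions \<open>f\<^sub>i\<close> independently for \<open>n i\<close> steps and
  failure parameter \<open>\<delta> / 2^(i + 1)\<close>, and let \<open>D\<close> be the law of their direct sum. Since the gradients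
  and higher derivatives of a direct sum are the sums of those of its summands, an algorithm for
  the direct sum can, with the other summands fixed, be run against \<open>f\<^sub>i\<close> alone. By Fubini, stage \<open>i\<close>
  then fails with probability at most \<open>2 \<delta> / 2^(i + 1)\<close>, and a union bound concludes.
\<close>

text \<open>The seed of an algorithm is a single uniform number, so the reduced algorithm playing
  against one summand does not draw the others itself: they are held fixed, and the bound is
  averaged over them afterwards. Two obstacles shape the reduction. The reduced algorithm has to be
  measurable in the answers it receives, so an answer for the direct sum is assembled from the
  oracle of one fixed member of \<open>Fc \<infinity>\<close> and a correction in a single term.
  Moreover, nothing controls the series of derivatives in advance; in the differentiable case the
  jet of the sum, known to exist, is tested along directions inside one block, where only one term
  of the series moves. The factor \<open>\<rho> (n i)\<close> absorbs the factor
  \<open>C * lam i * mu i ^ q\<close> that appears when the error of the i-th summand is carried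
  over to the sum. As \<open>C\<close> is common to all step counts and failure parameters,
  \<open>n\<close> can be fixed before \<delta>, while dimensions and hard laws are chosen after
  it.\<close>

section \<open>Blocks of a direct sum\<close>

lemma hilb_add_scaleR: "x \<in> hilb d \<Longrightarrow> h \<in> hilb d \<Longrightarrow> x + s *\<^sub>R h \<in> hilb d"
  by (simp add: hilb_def)

lemma hilb_scaleR: "x \<in> hilb d \<Longrightarrow> s *\<^sub>R x \<in> hilb d"
  by (simp add: hilb_def)

lemma block_add: "block ds i (x + y) = block ds i x + block ds i y"
  by (rule ell2_eqI) (simp add: coord_block)

lemma block_scaleR: "block ds i (s *\<^sub>R x) = s *\<^sub>R block ds i x"
  by (rule ell2_eqI) (simp add: coord_block)

lemma norm_block_le: "norm (block ds i x) \<le> norm x"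
proof (rule norm_ell2_le)
  fix k
  have "(\<Sum>l<k. (coord (block ds i x) l)\<^sup>2) \<le> (\<Sum>l<k. (coord x ((\<Sum>j<i. ds j) + l))\<^sup>2)"
    by (intro sum_mono) (simp add: coord_block)
  also have "\<dots> = (\<Sum>l\<in>{(\<Sum>j<i. ds j)..<(\<Sum>j<i. ds j) + k}. (coord x l)\<^sup>2)"
    using sum.shift_bounds_nat_ivl[of "\<lambda>l. (coord x l)\<^sup>2" 0 "\<Sum>j<i. ds j" k]
    by (simp add: atLeast0LessThan add.commute)
  also have "\<dots> \<le> (\<Sum>l<(\<Sum>j<i. ds j) + k. (coord x l)\<^sup>2)"
    by (intro sum_mono2) auto
  also have "\<dots> \<le> (norm x)\<^sup>2"
    by (rule sum_coord_squares_le)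
  finally show "(\<Sum>l<k. (coord (block ds i x) l)\<^sup>2) \<le> (norm x)\<^sup>2" .
qed simp

lemma bounded_linear_block: "bounded_linear (block ds i)"
  by (rule bounded_linear_intro[where K = 1])
    (simp_all add: block_add block_scaleR norm_block_le)

text \<open>The orthogonal projection onto the j-th summand of the big space. Unlike
  \<open>block\<close>, it leaves the coordinates in place, so its values can serve as directions
  for the direct sum.\<close>

definition component :: "(nat \<Rightarrow> nat) \<Rightarrow> nat \<Rightarrow> ell2 \<Rightarrow> ell2"
  where "component ds j h =
    Abs_ell2 (\<lambda>k. if (\<Sum>i<j. ds i) \<le> k \<and> k < (\<Sum>i<Suc j. ds i) then coord h k else 0)"

lemma coord_component:
  "coord (component ds j h) k =
    (if (\<Sum>i<j. ds i) \<le> k \<and> k < (\<Sum>i<Suc j. ds i) then coord h k else 0)"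
proof -
  have "summable (\<lambda>k. (if (\<Sum>i<j. ds i) \<le> k \<and> k < (\<Sum>i<Suc j. ds i) then coord h k else 0)\<^sup>2)"
    by (rule summable_finite[of "{..<\<Sum>i<Suc j. ds i}"]) auto
  then show ?thesis by (simp add: component_def Abs_ell2_inverse)
qed

text \<open>Runs of coordinates with different indices are disjoint, so moving along one component
  leaves all other blocks unchanged.\<close>

lemma block_component: "block ds i (component ds j h) = (if i = j then block ds j h else 0)"
proof (rule ell2_eqI)
  fix k
  have mono: "(\<Sum>l<Suc a. ds l) \<le> (\<Sum>l<b. ds l)" if "a < b" for a b
    using that by (intro sum_mono2) auto
  show "coord (block ds i (component ds j h)) k = coord (if i = j then block ds j h else 0) k"
    using mono[of i j] mono[of j i]
    by (cases i j rule: linorder_cases) (auto simp: coord_block coord_component)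
qed

text \<open>As every block has at least one coordinate, the first N components recover at least the
  first N coordinates of \<open>h\<close>; the remaining error is a tail of a convergent series of
  squares.\<close>

lemma component_sums:
  assumes "\<And>i. 1 \<le> ds i"
  shows "(\<lambda>j. component ds j h) sums h"
  unfolding sums_def
proof (rule metric_LIMSEQ_I)
  fix r :: real
  assume r: "0 < r"
  have coords: "coord (\<Sum>j<N. component ds j h) k = (if k < (\<Sum>i<N. ds i) then coord h k else 0)"
    for N k by (induction N) (auto simp: coord_component)
  have large: "N \<le> (\<Sum>i<N. ds i)" for N
    using sum_mono[of "{..<N}" "\<lambda>_. 1" ds] assms by simp
  obtain M where M: "\<And>m n. M \<le> m \<Longrightarrow> norm (\<Sum>k\<in>{m..<n}. (coord h k)\<^sup>2) < (r / 2)\<^sup>2"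
    using summable_coord[of h] r unfolding summable_Cauchy
    by (meson half_gt_zero zero_less_power)
  have "norm ((\<Sum>j<N. component ds j h) - h) \<le> r / 2" if "M \<le> N" for N
  proof (rule norm_ell2_le)
    fix n
    let ?S = "\<Sum>i<N. ds i"
    have "(\<Sum>k<n. (coord ((\<Sum>j<N. component ds j h) - h) k)\<^sup>2)
        = (\<Sum>k\<in>{?S..<n}. (coord h k)\<^sup>2)"
      by (rule sum.mono_neutral_cong_right) (auto simp: coords)
    also have "\<dots> \<le> (r / 2)\<^sup>2"
      using M[of ?S n] large[of N] that by (simp add: sum_nonneg)
    finally show "(\<Sum>k<n. (coord ((\<Sum>j<N. component ds j h) - h) k)\<^sup>2) \<le> (r / 2)\<^sup>2" .
  qed (use r in simp)
  then show "\<exists>M. \<forall>N\<ge>M. dist (\<Sum>j<N. component ds j h) h < r"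
    using r by (intro exI[of _ M]) (force simp: dist_norm)
qed

section \<open>The oracle of a direct sum\<close>

lemma multilinear_form_Cons:
  assumes "bounded_multilinear_form d (Suc (length hs)) T" "set hs \<subseteq> hilb d" "u \<in> hilb d" "v \<in> hilb d"
  shows "T ((a *\<^sub>R u + b *\<^sub>R v) # hs) = a * T (u # hs) + b * T (v # hs)"
proof -
  have "\<forall>gs j u v a b. set gs \<subseteq> hilb d \<and> length gs = Suc (length hs) \<and> j < Suc (length hs)
      \<and> u \<in> hilb d \<and> v \<in> hilb d \<longrightarrow>
      T (gs[j := a *\<^sub>R u + b *\<^sub>R v]) = a * T (gs[j := u]) + b * T (gs[j := v])"
    using assms(1) unfolding bounded_multilinear_form_def by blast
  from this[rule_format, of "u # hs" 0 u v a b] assms(2-4) show ?thesis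
    by simp
qed

text \<open>Continuity in the first slot is what allows a derivative to be evaluated on
  \<open>h\<close> as the sum of its values on the components of \<open>h\<close>.\<close>

lemma bounded_linear_multilinear_form_Cons:
  assumes T: "bounded_multilinear_form \<infinity> (Suc (length hs)) T"
  shows "bounded_linear (\<lambda>h. T (h # hs))"
proof -
  have U: "set gs \<subseteq> hilb \<infinity>" "u \<in> hilb \<infinity>" for gs u
    by (auto simp: hilb_infinity)
  obtain c where c: "\<And>gs. length gs = Suc (length hs) \<Longrightarrow> \<bar>T gs\<bar> \<le> c * prod_list (map norm gs)"
    using conjunct2[OF T[unfolded bounded_multilinear_form_def]] by (auto simp: hilb_infinity)
  note linear = multilinear_form_Cons[OF T U(1) U(2) U(2)]
  show ?thesis
  proof (rule bounded_linear_intro)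
    show "T ((u + v) # hs) = T (u # hs) + T (v # hs)" for u v
      using linear[of 1 u 1 v] by simp
    show "T ((r *\<^sub>R u) # hs) = r *\<^sub>R T (u # hs)" for r u
      using linear[of r u 0 u] by simp
    show "norm (T (u # hs)) \<le> norm u * (c * prod_list (map norm hs))" for u
      using c[of "u # hs"] by (simp add: ac_simps)
  qed
qed

text \<open>The Frechet estimate, uniform in the directions, is used here only for one list
  \<open>hs\<close> and along one line. This reduces all later comparisons of jets to uniqueness of
  derivatives of real functions.\<close>

lemma has_derivatives_directional:
  assumes D: "has_derivatives d p f D" and x: "x \<in> hilb d" and h: "h \<in> hilb d"
    and hs: "set hs \<subseteq> hilb d" "length hs < p"
  shows "((\<lambda>s. D (x + s *\<^sub>R h) hs) has_real_derivative D x (h # hs)) (at 0)"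
  unfolding DERIV_def
proof (rule LIM_I)
  fix e :: real
  assume e: "0 < e"
  define c where "c = norm h * prod_list (map norm hs)"
  have "0 \<le> prod_list (map norm hs)"
    by (rule prod_list_nonneg) auto
  then have c: "0 \<le> c" by (simp add: c_def)
  have form: "bounded_multilinear_form d (Suc (length hs)) (D x)"
    using D x hs unfolding has_derivatives_def by auto
  have lim: "\<forall>e>0. \<exists>r>0. \<forall>y\<in>hilb d. norm (y - x) < r \<longrightarrow>
      (\<forall>gs. set gs \<subseteq> hilb d \<and> length gs = length hs \<longrightarrow>
        \<bar>D y gs - D x gs - D x ((y - x) # gs)\<bar> \<le> e * norm (y - x) * prod_list (map norm gs))"
    using D x hs unfolding has_derivatives_def by blast
  \<comment> \<open>Adding 1 covers the case c = 0 and makes \<open>e / (c + 1) * c < e\<close>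
    strict. The radius \<open>r / (norm h + 1)\<close> is guarded in the same way against h =
    0.\<close>
  have "0 < e / (c + 1)" using e c by simp
  then obtain r where r: "0 < r" and "\<forall>y\<in>hilb d. norm (y - x) < r \<longrightarrow>
      (\<forall>gs. set gs \<subseteq> hilb d \<and> length gs = length hs \<longrightarrow>
        \<bar>D y gs - D x gs - D x ((y - x) # gs)\<bar> \<le> e / (c + 1) * norm (y - x) * prod_list (map norm gs))"
    using mp[OF spec[OF lim]] by blast
  then have close: "\<bar>D y hs - D x hs - D x ((y - x) # hs)\<bar>
      \<le> e / (c + 1) * norm (y - x) * prod_list (map norm hs)"
    if "y \<in> hilb d" "norm (y - x) < r" for y
    using that hs by simp
  have "\<bar>(D (x + s *\<^sub>R h) hs - D x hs) / s - D x (h # hs)\<bar> < e"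
    if s: "s \<noteq> 0" "\<bar>s\<bar> < r / (norm h + 1)" for s
  proof -
    have "\<bar>s\<bar> * norm h \<le> \<bar>s\<bar> * (norm h + 1)"
      by (intro mult_left_mono) auto
    also have "\<dots> < r"
      using s(2) by (simp add: pos_less_divide_eq add_nonneg_pos)
    finally have "norm ((x + s *\<^sub>R h) - x) < r" by simp
    from close[OF hilb_add_scaleR[OF x h] this]
    have "\<bar>D (x + s *\<^sub>R h) hs - D x hs - D x ((s *\<^sub>R h) # hs)\<bar> \<le> e / (c + 1) * \<bar>s\<bar> * c"
      by (simp add: c_def ac_simps)
    moreover have "D x ((s *\<^sub>R h) # hs) = s * D x (h # hs)"
      using multilinear_form_Cons[OF form hs(1) h h, of s 0] by simp
    ultimately have "\<bar>D (x + s *\<^sub>R h) hs - D x hs - s * D x (h # hs)\<bar> / \<bar>s\<bar> \<le> e / (c + 1) * c"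
      using s(1) by (simp add: pos_divide_le_eq ac_simps)
    moreover have "\<bar>D (x + s *\<^sub>R h) hs - D x hs - s * D x (h # hs)\<bar> / \<bar>s\<bar>
        = \<bar>(D (x + s *\<^sub>R h) hs - D x hs) / s - D x (h # hs)\<bar>"
      using s(1) by (simp add: abs_divide[symmetric] diff_divide_distrib)
    moreover have "e / (c + 1) * c < e"
      using e c by (simp add: pos_divide_less_eq algebra_simps)
    ultimately show ?thesis by linarith
  qed
  moreover have "0 < r / (norm h + 1)" using r by (simp add: add_nonneg_pos)
  ultimately show "\<exists>r>0. \<forall>s. s \<noteq> 0 \<and> norm (s - 0) < r \<longrightarrow>
      norm ((D (x + (0 + s) *\<^sub>R h) hs - D (x + 0 *\<^sub>R h) hs) / s - D x (h # hs)) < e"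
    by (intro exI[of _ "r / (norm h + 1)"]) auto
qed

lemma is_oracle_value:
  assumes "is_oracle d p f orc" "x \<in> hilb d"
  shows "orc x [] = f x"
  using assms unfolding is_oracle_def has_derivatives_def directions_def by auto

lemma is_oracle_extensional:
  assumes "is_oracle d p f orc" "x \<in> hilb d"
  shows "orc x \<in> extensional (directions p d)"
  using assms unfolding is_oracle_def by auto

text \<open>Stated without assuming differentiability of \<open>f\<close>: a subgradient is tested against
  both directions \<open>\<plusminus>h\<close>.\<close>

lemma is_oracle_directional:
  assumes orc: "is_oracle d p f orc" and x: "x \<in> hilb d" and h: "h \<in> hilb d"
    and hs: "set hs \<subseteq> hilb d" "length hs < p"
    and L: "((\<lambda>s. orc (x + s *\<^sub>R h) hs) has_real_derivative L) (at 0)"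
  shows "orc x (h # hs) = L"
  using orc unfolding is_oracle_def
proof (elim disjE exE conjE)
  fix D
  assume D: "has_derivatives d p f D" "\<forall>x\<in>hilb d. orc x = restrict (D x) (directions p d)"
  have "(\<lambda>s. orc (x + s *\<^sub>R h) hs) = (\<lambda>s. D (x + s *\<^sub>R h) hs)"
    using D(2) hs hilb_add_scaleR[OF x h] by (simp add: directions_def)
  with L have "D x (h # hs) = L"
    using has_derivatives_directional[OF D(1) x h hs] by (metis DERIV_unique)
  then show ?thesis
    using D(2) x h hs by (simp add: directions_def)
next
  assume p: "p = 1" and g: "\<forall>x\<in>hilb d. \<exists>g\<in>subdifferential d f x.
    orc x = (\<lambda>hs\<in>directions p d. if hs = [] then f x else g \<bullet> hd hs)"
  have [simp]: "hs = []" using p hs by simp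
  obtain g where sub: "g \<in> subdifferential d f x"
    and "orc x = (\<lambda>hs\<in>directions p d. if hs = [] then f x else g \<bullet> hd hs)"
    using g x by blast
  then have val: "orc x (h # hs) = g \<bullet> h"
    using h p by (simp add: directions_def)
  have "f (x + s *\<^sub>R h) \<ge> f x + s * (g \<bullet> h)" for s
    using sub hilb_add_scaleR[OF x h, of s] unfolding subdifferential_def by force
  \<comment> \<open>Subtracting the linear minorant leaves a function of s with a minimum at 0, so
    its derivative \<open>L - g \<bullet> h\<close> vanishes. The zero terms are written out to
    match the form of the minimum criterion.\<close>
  then have "orc (x + s *\<^sub>R h) hs - s * (g \<bullet> h) \<ge> orc (x + 0 *\<^sub>R h) hs - 0 * (g \<bullet> h)" for s
    using is_oracle_value[OF orc hilb_add_scaleR[OF x h, of s]] is_oracle_value[OF orc x]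
    by (simp add: algebra_simps)
  moreover have "((\<lambda>s. orc (x + s *\<^sub>R h) hs - s * (g \<bullet> h)) has_real_derivative L - g \<bullet> h) (at 0)"
    by (rule derivative_eq_intros L refl)+ simp
  ultimately have "L - g \<bullet> h = 0"
    by (intro DERIV_local_min[where d = 1]) auto
  then show ?thesis using val by simp
qed

text \<open>The oracle may be of the subgradient kind even though \<open>f\<close> is
  differentiable. Both jets start from the function value, and each further entry is the directional
  derivative of a shorter one, so induction on the list makes them agree.\<close>

lemma is_oracle_has_derivatives:
  assumes orc: "is_oracle d p f orc" and D: "has_derivatives d p f D"
  shows "x \<in> hilb d \<Longrightarrow> hs \<in> directions p d \<Longrightarrow> orc x hs = D x hs"
proof (induction hs arbitrary: x)
  case Nil
  then show ?case
    using is_oracle_value[OF orc] D by (simp add: has_derivatives_def)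
next
  case (Cons h hs)
  then have h: "h \<in> hilb d" and hs: "set hs \<subseteq> hilb d" "length hs < p"
    by (auto simp: directions_def)
  then have "(\<lambda>s. orc (x + s *\<^sub>R h) hs) = (\<lambda>s. D (x + s *\<^sub>R h) hs)"
    using Cons.IH hilb_add_scaleR[OF Cons.prems(1) h] by (simp add: directions_def)
  then show ?case
    using is_oracle_directional[OF orc Cons.prems(1) h hs]
      has_derivatives_directional[OF D Cons.prems(1) h hs] by metis
qed

text \<open>Induction on the list of directions. The first direction is split into components; along
  the j-th one the difference quotient of the series is that of a single term, and each step
  contributes one factor \<open>mu j\<close> by the chain rule. Only the sum is assumed
  differentiable: for the summands the derivative along the line is deduced, and their oracle must
  then report it.\<close>

lemma direct_sum_derivatives:
  assumes lam: "\<And>j. 0 < lam j" and mu: "\<And>j. 0 < mu j" and ds: "\<And>j. 1 \<le> ds j"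
    and summable: "\<And>x. summable (\<lambda>j. lam j * fs j (mu j *\<^sub>R block ds j x))"
    and orc: "\<And>j. is_oracle (enat (ds j)) p (fs j) (os j)"
    and D: "has_derivatives \<infinity> p (direct_sum lam mu ds fs) D"
  shows "length hs \<le> p \<Longrightarrow>
    (\<lambda>j. lam j * mu j ^ length hs * os j (mu j *\<^sub>R block ds j x) (map (block ds j) hs)) sums D x hs"
proof (induction hs arbitrary: x)
  case Nil
  have "D x [] = direct_sum lam mu ds fs x"
    using D by (simp add: has_derivatives_def hilb_infinity)
  then show ?case
    using is_oracle_value[OF orc] summable_sums[OF summable]
    by (simp add: direct_sum_def hilb_scaleR block_in_hilb)
next
  case (Cons h hs)
  then have hs: "length hs < p" by simp
  note IH = Cons.IH[OF less_imp_le[OF hs]]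
  have "bounded_multilinear_form \<infinity> (Suc (length hs)) (D x)"
    using D Cons.prems by (simp add: has_derivatives_def hilb_infinity)
  then interpret T: bounded_linear "\<lambda>h. D x (h # hs)"
    by (rule bounded_linear_multilinear_form_Cons)
  have "(\<lambda>j. D x (component ds j h # hs)) sums D x (h # hs)"
    by (rule T.sums) (rule component_sums[OF ds])
  moreover have "D x (component ds j h # hs) =
      lam j * mu j ^ length (h # hs) * os j (mu j *\<^sub>R block ds j x) (map (block ds j) (h # hs))" for j
  proof -
    let ?y = "mu j *\<^sub>R block ds j x" and ?h = "block ds j h" and ?hs = "map (block ds j) hs"
    let ?c = "lam j * mu j ^ length hs"
    have c: "?c \<noteq> 0" using lam[of j] mu[of j] by simp
    \<comment> \<open>moving along the \<open>j\<close>-th component changes only the \<open>j\<close>-th term of the series\<close>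
    have diff: "D (x + s *\<^sub>R component ds j h) hs - D x hs
        = ?c * (os j (?y + (mu j * s) *\<^sub>R ?h) ?hs - os j ?y ?hs)" for s
    proof -
      define diff_term where "diff_term i =
          lam i * mu i ^ length hs * os i (mu i *\<^sub>R block ds i (x + s *\<^sub>R component ds j h)) (map (block ds i) hs)
        - lam i * mu i ^ length hs * os i (mu i *\<^sub>R block ds i x) (map (block ds i) hs)" for i
      have "diff_term sums (D (x + s *\<^sub>R component ds j h) hs - D x hs)"
        unfolding diff_term_def by (intro sums_diff IH)
      moreover have "diff_term i = 0" if "i \<notin> {j}" for i
        using that by (simp add: diff_term_def block_add block_scaleR block_component)
      then have "diff_term sums (\<Sum>i\<in>{j}. diff_term i)"
        by (intro sums_finite) auto
      moreover have "diff_term j = ?c * (os j (?y + (mu j * s) *\<^sub>R ?h) ?hs - os j ?y ?hs)"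
        by (simp add: diff_term_def block_add block_scaleR block_component scaleR_add_right
          right_diff_distrib)
      ultimately show ?thesis using sums_unique2[of diff_term] by simp
    qed
    \<comment> \<open>The previous identity solved for the oracle of the summand; dividing s by
      \<open>mu j\<close> makes the argument move by exactly s times \<open>?h\<close>.\<close>
    have shift: "os j (?y + s *\<^sub>R ?h) ?hs
        = os j ?y ?hs + (D (x + (s / mu j) *\<^sub>R component ds j h) hs - D x hs) / ?c" for s
    proof -
      have "mu j * (s / mu j) = s" using less_imp_neq[OF mu[of j]] by simp
      then show ?thesis unfolding diff using c by simp
    qed
    \<comment> \<open>The base point 0 is written \<open>0 / mu j\<close>, the value at 0 of the
      inner map in the chain rule that follows.\<close>
    have "((\<lambda>s. D (x + s *\<^sub>R component ds j h) hs) has_real_derivative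
        D x (component ds j h # hs)) (at (0 / mu j))"
      using has_derivatives_directional[OF D, of x "component ds j h" hs] hs
      by (simp add: hilb_infinity)
    then have "((\<lambda>s. D (x + (s / mu j) *\<^sub>R component ds j h) hs) has_real_derivative
        D x (component ds j h # hs) * (1 / mu j)) (at 0)"
      by (rule DERIV_chain2) (rule DERIV_cdivide[OF DERIV_ident])
    then have "((\<lambda>s. os j (?y + s *\<^sub>R ?h) ?hs) has_real_derivative
        D x (component ds j h # hs) * (1 / mu j) / ?c) (at 0)"
      unfolding shift using c by (auto intro!: derivative_eq_intros)
    then have "os j ?y (?h # ?hs) = D x (component ds j h # hs) * (1 / mu j) / ?c"
      using hs by (intro is_oracle_directional[OF orc]) (auto intro: block_in_hilb hilb_scaleR)
    then show ?thesis
      using c mu[of j] by (simp add: field_simps)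
  qed
  ultimately show ?case by simp
qed

section \<open>Replaying an algorithm\<close>

text \<open>Iterates of \<open>A\<close> recomputed from a record of foreign answers, each
  translated by \<open>R\<close> at the point where \<open>A\<close> asked. The argument
  \<open>w\<close> is a pair of seed and record, as for an algorithm, so composing with a map of
  points yields an algorithm again.\<close>

function replay ::
    "algorithm \<Rightarrow> (ell2 \<Rightarrow> (ell2 list \<Rightarrow> real) \<Rightarrow> ell2 list \<Rightarrow> real) \<Rightarrow> real \<times> (nat \<Rightarrow> ell2 list \<Rightarrow> real) \<Rightarrow> nat \<Rightarrow> ell2"
  where "replay A R w t =
    A t (fst w, \<lambda>s. if s \<in> {1..<t} then R (replay A R w s) (snd w s) else undefined)"
  by auto
termination by (relation "Wellfounded.measure (\<lambda>(_, _, _, t). t)") auto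

declare replay.simps [simp del]

text \<open>\<open>R\<close> translates an answer of \<open>o1\<close> at \<open>g x\<close> into
  the answer of \<open>o2\<close> at \<open>x\<close>; hence the replayed \<open>A\<close> always
  sees what it would see when run against \<open>o2\<close>.\<close>

lemma iterate_replay:
  assumes "\<And>x. R x (o1 (g x)) = o2 x"
  shows "iterate (\<lambda>t w. g (replay A R w t)) o1 xi t = g (iterate A o2 xi t)"
proof (induction t rule: less_induct)
  case outer: (less t)
  define r where "r = (\<lambda>s. if s \<in> {1..<t} then o1 (iterate (\<lambda>t w. g (replay A R w t)) o1 xi s) else undefined)"
  \<comment> \<open>At time t the replay recomputes every earlier iterate of \<open>A\<close> from
    the record, hence a second induction. The outer hypothesis identifies the recorded answers
    before t.\<close>
  have "replay A R (xi, r) u = iterate A o2 xi u" if "u \<le> t" for u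
    using that
  proof (induction u rule: less_induct)
    case (less u)
    have "R (replay A R (xi, r) s) (r s) = o2 (iterate A o2 xi s)" if "s \<in> {1..<u}" for s
      using that less assms outer by (simp add: r_def)
    then show ?case
      unfolding replay.simps[of A R _ u] iterate.simps[of A _ _ u] by (simp cong: if_cong)
  qed
  then show ?case
    by (simp add: iterate.simps[of _ o1] r_def)
qed

text \<open>The index set \<open>I\<close> is kept independent of t because the induction needs the
  earlier iterates as functions of the whole record, not only of the answers preceding them.\<close>

lemma measurable_replay:
  assumes A: "rand_algorithm p d A"
    and R: "(\<lambda>(x, T). R x T) \<in> measurable (point_space d \<Otimes>\<^sub>M J) (jet_space p d)"
  shows "1 \<le> t \<Longrightarrow> {1..<t} \<subseteq> I \<Longrightarrow>
    (\<lambda>w. replay A R w t) \<in> measurable (unif01 \<Otimes>\<^sub>M Pi\<^sub>M I (\<lambda>_. J)) (point_space d)"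
proof (induction t rule: less_induct)
  case (less t)
  let ?M = "unif01 \<Otimes>\<^sub>M Pi\<^sub>M I (\<lambda>_. J)"
  have "(\<lambda>w. R (replay A R w s) (snd w s)) \<in> measurable ?M (jet_space p d)" if s: "s \<in> {1..<t}" for s
  proof -
    have "(\<lambda>w. replay A R w s) \<in> measurable ?M (point_space d)"
      using s less.prems by (intro less.IH) auto
    moreover have "(\<lambda>w. snd w s) \<in> measurable ?M J"
      using s less.prems(2)
      by (intro measurable_compose[OF measurable_snd measurable_component_singleton]) auto
    ultimately have "(\<lambda>w. (replay A R w s, snd w s)) \<in> measurable ?M (point_space d \<Otimes>\<^sub>M J)"
      by (rule measurable_Pair)
    from measurable_compose[OF this R] show ?thesis by simp
  qed
  then have "(\<lambda>w. (fst w, \<lambda>s\<in>{1..<t}. R (replay A R w s) (snd w s)))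
      \<in> measurable ?M (unif01 \<Otimes>\<^sub>M Pi\<^sub>M {1..<t} (\<lambda>_. jet_space p d))"
    by (intro measurable_Pair measurable_fst measurable_restrict)
  moreover have "A t \<in> measurable (unif01 \<Otimes>\<^sub>M Pi\<^sub>M {1..<t} (\<lambda>_. jet_space p d)) (point_space d)"
    using A less.prems by (simp add: rand_algorithm_def)
  ultimately show ?case
    unfolding replay.simps[of A R _ t] restrict_def[symmetric] by (rule measurable_compose)
qed

lemma measurable_iterate:
  assumes A: "rand_algorithm p d A"
    and orc: "(\<lambda>(x, f). orc f x) \<in> measurable (point_space d \<Otimes>\<^sub>M M) (jet_space p d)"
  shows "1 \<le> t \<Longrightarrow> (\<lambda>w. iterate A (orc (snd w)) (fst w) t) \<in> measurable (unif01 \<Otimes>\<^sub>M M) (point_space d)"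
proof (induction t rule: less_induct)
  case (less t)
  have "(\<lambda>w. orc (snd w) (iterate A (orc (snd w)) (fst w) s)) \<in> measurable (unif01 \<Otimes>\<^sub>M M) (jet_space p d)"
    if s: "s \<in> {1..<t}" for s
  proof -
    have "(\<lambda>w. (iterate A (orc (snd w)) (fst w) s, snd w)) \<in> measurable (unif01 \<Otimes>\<^sub>M M) (point_space d \<Otimes>\<^sub>M M)"
      using s by (intro measurable_Pair measurable_snd less.IH) auto
    from measurable_compose[OF this orc] show ?thesis by simp
  qed
  then have "(\<lambda>w. (fst w, \<lambda>s\<in>{1..<t}. orc (snd w) (iterate A (orc (snd w)) (fst w) s)))
      \<in> measurable (unif01 \<Otimes>\<^sub>M M) (unif01 \<Otimes>\<^sub>M Pi\<^sub>M {1..<t} (\<lambda>_. jet_space p d))"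
    by (intro measurable_Pair measurable_fst measurable_restrict)
  moreover have "A t \<in> measurable (unif01 \<Otimes>\<^sub>M Pi\<^sub>M {1..<t} (\<lambda>_. jet_space p d)) (point_space d)"
    using A less.prems by (simp add: rand_algorithm_def)
  ultimately show ?case
    unfolding iterate.simps[of A _ _ t] restrict_def[symmetric] by (rule measurable_compose)
qed

section \<open>Replacing one summand\<close>

lemma bounded_multilinear_form_cong:
  assumes "\<And>hs. set hs \<subseteq> hilb d \<Longrightarrow> length hs = k \<Longrightarrow> S hs = T hs"
    and "bounded_multilinear_form d k T"
  shows "bounded_multilinear_form d k S"
proof -
  have upd: "set (hs[j := a *\<^sub>R u + b *\<^sub>R v]) \<subseteq> hilb d" "set (hs[j := u]) \<subseteq> hilb d"
    if "set hs \<subseteq> hilb d" "u \<in> hilb d" "v \<in> hilb d" for hs :: "ell2 list" and j u v a b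
    using that set_update_subset_insert[of hs j] by (fastforce intro: hilb_add_scaleR hilb_scaleR)+
  show ?thesis
    using assms(2) upd unfolding bounded_multilinear_form_def by (auto simp: assms(1))
qed

lemma bounded_multilinear_form_lincomb:
  assumes S: "bounded_multilinear_form d k S" and T: "bounded_multilinear_form d k T"
  shows "bounded_multilinear_form d k (\<lambda>hs. S hs + a * T hs)"
proof -
  obtain c c' where c: "\<forall>hs. set hs \<subseteq> hilb d \<and> length hs = k \<longrightarrow> \<bar>S hs\<bar> \<le> c * prod_list (map norm hs)"
      "\<forall>hs. set hs \<subseteq> hilb d \<and> length hs = k \<longrightarrow> \<bar>T hs\<bar> \<le> c' * prod_list (map norm hs)"
    using S T unfolding bounded_multilinear_form_def by meson
  have "\<bar>S hs + a * T hs\<bar> \<le> (c + \<bar>a\<bar> * c') * prod_list (map norm hs)"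
    if "set hs \<subseteq> hilb d \<and> length hs = k" for hs
  proof -
    have "\<bar>a * T hs\<bar> \<le> \<bar>a\<bar> * (c' * prod_list (map norm hs))"
      using c(2) that by (simp add: abs_mult mult_left_mono)
    then show ?thesis
      using c(1)[rule_format, OF that] by (simp add: algebra_simps)
  qed
  moreover have "\<forall>hs j u v b b'. set hs \<subseteq> hilb d \<and> length hs = k \<and> j < k \<and> u \<in> hilb d \<and> v \<in> hilb d \<longrightarrow>
      S (hs[j := b *\<^sub>R u + b' *\<^sub>R v]) + a * T (hs[j := b *\<^sub>R u + b' *\<^sub>R v])
      = b * (S (hs[j := u]) + a * T (hs[j := u])) + b' * (S (hs[j := v]) + a * T (hs[j := v]))"
    using conjunct1[OF S[unfolded bounded_multilinear_form_def]]
      conjunct1[OF T[unfolded bounded_multilinear_form_def]]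
    by (simp add: algebra_simps)
  ultimately show ?thesis
    unfolding bounded_multilinear_form_def by blast
qed

lemma bounded_multilinear_form_block:
  assumes T: "bounded_multilinear_form (enat (ds i)) k T"
  shows "bounded_multilinear_form \<infinity> k (\<lambda>hs. T (map (block ds i) hs))"
proof -
  have B: "set (map (block ds i) hs) \<subseteq> hilb (enat (ds i))" for hs
    by (auto intro: block_in_hilb)
  obtain c where c: "\<And>hs. set hs \<subseteq> hilb (enat (ds i)) \<Longrightarrow> length hs = k \<Longrightarrow>
      \<bar>T hs\<bar> \<le> c * prod_list (map norm hs)"
    using T unfolding bounded_multilinear_form_def by meson
  have norms: "0 \<le> prod_list (map norm (map (block ds i) hs)) \<and>
      prod_list (map norm (map (block ds i) hs)) \<le> prod_list (map norm hs)" for hs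
    by (induction hs) (auto intro!: mult_mono norm_block_le)
  \<comment> \<open>The constant \<open>c\<close> need not be nonnegative;
    \<open>\<bar>c\<bar>\<close> permits replacing the norms of the blocks by the larger norms of
    the directions.\<close>
  have "\<bar>T (map (block ds i) hs)\<bar> \<le> \<bar>c\<bar> * prod_list (map norm hs)" if "length hs = k" for hs
  proof -
    have "\<bar>T (map (block ds i) hs)\<bar> \<le> c * prod_list (map norm (map (block ds i) hs))"
      using c[OF B] that by simp
    also have "\<dots> \<le> \<bar>c\<bar> * prod_list (map norm hs)"
      using norms[of hs] by (intro mult_mono) auto
    finally show ?thesis .
  qed
  moreover have "T (map (block ds i) (hs[j := a *\<^sub>R u + b *\<^sub>R v]))
      = a * T (map (block ds i) (hs[j := u])) + b * T (map (block ds i) (hs[j := v]))"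
    if "length hs = k" "j < k" for hs j u v a b
    using conjunct1[OF T[unfolded bounded_multilinear_form_def],
        THEN spec, of "map (block ds i) hs"] that B[of hs]
    by (simp add: map_update block_add block_scaleR block_in_hilb)
  ultimately show ?thesis
    unfolding bounded_multilinear_form_def by blast
qed

section \<open>Measurability of jets and blocks\<close>

lemma space_jet_space:
  "T \<in> space (jet_space p d) \<longleftrightarrow>
    T \<in> extensional (directions p d) \<and> (\<forall>k\<le>p. bounded_multilinear_form d k T)"
  by (auto simp: jet_space_def space_restrict_space space_PiM PiE_def)

lemma measurable_jet_eval:
  "hs \<in> directions p d \<Longrightarrow> (\<lambda>T. T hs) \<in> borel_measurable (jet_space p d)"
  unfolding jet_space_def by (intro measurable_restrict_space1 measurable_component_singleton)

lemma map_block_directions: "hs \<in> directions p \<infinity> \<Longrightarrow> map (block ds i) hs \<in> directions p (enat (ds i))"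
  by (auto simp: directions_def block_in_hilb)

lemma space_point_space: "space (point_space d) = hilb d"
  by (simp add: point_space_def space_restrict_space)

lemma sets_point_space_infinity: "sets (point_space \<infinity>) = sets borel"
  by (simp add: point_space_def hilb_infinity)

lemma measurable_block:
  "(\<lambda>x. c *\<^sub>R block ds i x) \<in> measurable (point_space \<infinity>) (point_space (enat (ds i)))"
proof -
  have "continuous_on UNIV (\<lambda>x. c *\<^sub>R block ds i x)"
    by (intro continuous_intros linear_continuous_on bounded_linear_block)
  then have "(\<lambda>x. c *\<^sub>R block ds i x) \<in> borel_measurable borel"
    by (rule borel_measurable_continuous_onI)
  then have "(\<lambda>x. c *\<^sub>R block ds i x) \<in> borel_measurable (point_space \<infinity>)"
    by (simp add: measurable_cong_sets[OF sets_point_space_infinity refl])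
  then show ?thesis
    unfolding point_space_def[of "enat (ds i)"]
    by (intro measurable_restrict_space2) (auto intro: hilb_scaleR block_in_hilb)
qed

locale direct_sum_classes =
  fixes Fc :: "enat \<Rightarrow> (ell2 \<Rightarrow> real) set"
    and eps :: "enat \<Rightarrow> ell2 \<Rightarrow> (ell2 \<Rightarrow> real) \<Rightarrow> real"
    and orc :: "enat \<Rightarrow> (ell2 \<Rightarrow> real) \<Rightarrow> ell2 \<Rightarrow> ell2 list \<Rightarrow> real"
    and lam mu :: "nat \<Rightarrow> real"
    and p q :: nat
  assumes classes: "function_classes Fc"
    and error: "error_metric Fc eps"
    and direct_sums: "direct_sum_property Fc eps q lam mu"
    and oracles: "oracle_well_defined p Fc orc"
    and selection: "selection_respects_sums p Fc orc lam mu"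
begin

lemma lam_pos: "0 < lam i" and mu_pos: "0 < mu i"
  using direct_sums by (auto simp: direct_sum_property_def)

lemma space_fun_space: "1 \<le> d \<Longrightarrow> space (fun_space d (Fc d)) = Fc d"
  using classes unfolding function_classes_def fun_space_def
  by (auto simp: space_restrict_space space_PiM)

lemma measurable_oracle:
  "1 \<le> d \<Longrightarrow> (\<lambda>(x, f). orc d f x) \<in> measurable (point_space d \<Otimes>\<^sub>M fun_space d (Fc d)) (jet_space p d)"
  using oracles by (simp add: oracle_well_defined_def)

lemma measurable_error:
  "1 \<le> d \<Longrightarrow> (\<lambda>(x, f). eps d x f) \<in> borel_measurable (point_space d \<Otimes>\<^sub>M fun_space d (Fc d))"
  using error by (simp add: error_metric_def)

lemma measurable_oracle_section:
  assumes d: "1 \<le> d" and f: "f \<in> Fc d"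
  shows "orc d f \<in> measurable (point_space d) (jet_space p d)"
proof -
  have "(\<lambda>x. (x, f)) \<in> measurable (point_space d) (point_space d \<Otimes>\<^sub>M fun_space d (Fc d))"
    using f space_fun_space[OF d] by (intro measurable_Pair measurable_ident measurable_const) auto
  from measurable_compose[OF this measurable_oracle[OF d]] show ?thesis by simp
qed

lemma measurable_iterate_error:
  assumes d: "1 \<le> d" and A: "rand_algorithm p d A" and t: "1 \<le> t"
  shows "(\<lambda>w. eps d (iterate A (orc d (snd w)) (fst w) t) (snd w))
    \<in> borel_measurable (unif01 \<Otimes>\<^sub>M fun_space d (Fc d))"
proof -
  have "(\<lambda>w. (iterate A (orc d (snd w)) (fst w) t, snd w))
      \<in> measurable (unif01 \<Otimes>\<^sub>M fun_space d (Fc d)) (point_space d \<Otimes>\<^sub>M fun_space d (Fc d))"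
    by (intro measurable_Pair measurable_snd measurable_iterate[OF A measurable_oracle[OF d] t])
  from measurable_compose[OF this measurable_error[OF d]] show ?thesis by simp
qed

end

text \<open>The dimensions come from the lower bound and depend on \<delta>, so this locale is
  interpreted only once \<delta> has been given.\<close>

locale direct_sum_dims = direct_sum_classes +
  fixes ds :: "nat \<Rightarrow> nat"
  assumes dims: "\<And>i. 1 \<le> ds i"
begin

lemma dims_enat: "1 \<le> enat (ds i)"
  using dims[of i] by (simp add: one_enat_def)

lemma
  assumes "\<And>i. fs i \<in> Fc (enat (ds i))"
  shows summable_direct_sum: "summable (\<lambda>i. lam i * fs i (mu i *\<^sub>R block ds i x))"
    and direct_sum_in_class: "direct_sum lam mu ds fs \<in> Fc \<infinity>"
    and error_direct_sum: "eps \<infinity> x (direct_sum lam mu ds fs)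
        \<ge> lam i * mu i ^ q * eps (enat (ds i)) (mu i *\<^sub>R block ds i x) (fs i)"
  using direct_sums assms dims unfolding direct_sum_property_def by blast+

text \<open>If the sum is not p times differentiable, its oracle must be of the subgradient kind.
  Then p = 1, only lists of length at most 1 occur, and the gradient is covered by the consistency
  of the selection.\<close>

lemma oracle_direct_sum:
  assumes fs: "\<And>i. fs i \<in> Fc (enat (ds i))" and hs: "length hs \<le> p"
  shows "(\<lambda>j. lam j * mu j ^ length hs *
      orc (enat (ds j)) (fs j) (mu j *\<^sub>R block ds j x) (map (block ds j) hs))
    sums orc \<infinity> (direct_sum lam mu ds fs) x hs"
proof -
  let ?F = "direct_sum lam mu ds fs"
  have orc_fs: "is_oracle (enat (ds j)) p (fs j) (orc (enat (ds j)) (fs j))" for j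
    using oracles dims_enat fs by (simp add: oracle_well_defined_def)
  have orc_F: "is_oracle \<infinity> p ?F (orc \<infinity> ?F)"
    using oracles direct_sum_in_class[OF fs] by (simp add: oracle_well_defined_def)
  show ?thesis
  proof (cases "times_differentiable \<infinity> p ?F")
    case True
    then obtain D where D: "has_derivatives \<infinity> p ?F D"
      by (auto simp: times_differentiable_def)
    have "orc \<infinity> ?F x hs = D x hs"
      using hs by (intro is_oracle_has_derivatives[OF orc_F D]) (auto simp: hilb_infinity directions_def)
    then show ?thesis
      using direct_sum_derivatives[OF lam_pos mu_pos dims summable_direct_sum[OF fs] orc_fs D hs]
      by simp
  next
    case False
    then have "p = 1"
      using orc_F unfolding is_oracle_def times_differentiable_def by blast
    then consider "hs = []" | h where "hs = [h]"
      using hs by (cases hs) auto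
    then show ?thesis
    proof cases
      case 1
      have "orc (enat (ds j)) (fs j) (mu j *\<^sub>R block ds j x) [] = fs j (mu j *\<^sub>R block ds j x)" for j
        using is_oracle_value[OF orc_fs] by (simp add: hilb_scaleR block_in_hilb)
      moreover have "orc \<infinity> ?F x [] = ?F x"
        using is_oracle_value[OF orc_F] by (simp add: hilb_infinity)
      ultimately show ?thesis
        using 1 summable_sums[OF summable_direct_sum[OF fs, of x]] by (simp add: direct_sum_def)
    next
      case 2
      then show ?thesis
        using selection dims fs False unfolding selection_respects_sums_def by simp
    qed
  qed
qed

text \<open>Turns the answer \<open>T\<close> of the oracle of an unknown function at the \<open>i\<close>-th block of \<open>x\<close>
  into the answer at \<open>x\<close> for the direct sum with that function in place of \<open>fs i\<close>.\<close>

definition substitute_answer ::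
    "(nat \<Rightarrow> ell2 \<Rightarrow> real) \<Rightarrow> nat \<Rightarrow> ell2 \<Rightarrow> (ell2 list \<Rightarrow> real) \<Rightarrow> ell2 list \<Rightarrow> real"
  where "substitute_answer fs i x T = (\<lambda>hs\<in>directions p \<infinity>.
    orc \<infinity> (direct_sum lam mu ds fs) x hs + lam i * mu i ^ length hs *
      (T (map (block ds i) hs)
        - orc (enat (ds i)) (fs i) (mu i *\<^sub>R block ds i x) (map (block ds i) hs)))"

text \<open>The answers for the two direct sums are series that differ only in the i-th term.
  Outside \<open>directions p \<infinity>\<close> both sides are \<open>undefined\<close>.\<close>

lemma substitute_answer_oracle:
  assumes fs: "\<And>i. fs i \<in> Fc (enat (ds i))" and f: "f \<in> Fc (enat (ds i))"
  shows "substitute_answer fs i x (orc (enat (ds i)) f (mu i *\<^sub>R block ds i x))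
    = orc \<infinity> (direct_sum lam mu ds (fs(i := f))) x"
proof
  fix hs
  have gs: "(fs(i := f)) j \<in> Fc (enat (ds j))" for j
    using fs f by simp
  show "substitute_answer fs i x (orc (enat (ds i)) f (mu i *\<^sub>R block ds i x)) hs
    = orc \<infinity> (direct_sum lam mu ds (fs(i := f))) x hs"
  proof (cases "hs \<in> directions p \<infinity>")
    case True
    then have hs: "length hs \<le> p" by (simp add: directions_def)
    define summand where "summand g j = lam j * mu j ^ length hs *
        orc (enat (ds j)) (g j) (mu j *\<^sub>R block ds j x) (map (block ds j) hs)" for g j
    have "(\<lambda>j. summand (fs(i := f)) j - summand fs j)
        sums (orc \<infinity> (direct_sum lam mu ds (fs(i := f))) x hs - orc \<infinity> (direct_sum lam mu ds fs) x hs)"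
      unfolding summand_def by (intro sums_diff oracle_direct_sum gs fs hs)
    moreover have "(\<lambda>j. summand (fs(i := f)) j - summand fs j)
        sums (\<Sum>j\<in>{i}. summand (fs(i := f)) j - summand fs j)"
      by (intro sums_finite) (auto simp: summand_def)
    ultimately have "orc \<infinity> (direct_sum lam mu ds (fs(i := f))) x hs - orc \<infinity> (direct_sum lam mu ds fs) x hs
        = summand (fs(i := f)) i - summand fs i"
      using sums_unique2 by fastforce
    then show ?thesis
      using True by (simp add: substitute_answer_def summand_def right_diff_distrib)
  next
    case False
    have "is_oracle \<infinity> p (direct_sum lam mu ds (fs(i := f))) (orc \<infinity> (direct_sum lam mu ds (fs(i := f))))"
      using oracles direct_sum_in_class[of "fs(i := f)"] gs by (simp add: oracle_well_defined_def)
    then have "orc \<infinity> (direct_sum lam mu ds (fs(i := f))) x \<in> extensional (directions p \<infinity>)"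
      by (rule is_oracle_extensional) (simp add: hilb_infinity)
    with False show ?thesis
      by (simp add: substitute_answer_def extensional_def)
  qed
qed

text \<open>Evaluations generate the sigma-algebra on jets, so measurability is checked one list at
  a time, where the oracles of the fixed functions enter as sections. It remains to see that the
  values are jets.\<close>

lemma measurable_substitute_answer:
  assumes fs: "\<And>i. fs i \<in> Fc (enat (ds i))"
  shows "(\<lambda>(x, T). substitute_answer fs i x T)
    \<in> measurable (point_space \<infinity> \<Otimes>\<^sub>M jet_space p (enat (ds i))) (jet_space p \<infinity>)"
proof -
  let ?M = "point_space \<infinity> \<Otimes>\<^sub>M jet_space p (enat (ds i))" and ?F = "direct_sum lam mu ds fs"
  let ?o = "\<lambda>x. orc (enat (ds i)) (fs i) (mu i *\<^sub>R block ds i x)"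
  have F: "orc \<infinity> ?F \<in> measurable (point_space \<infinity>) (jet_space p \<infinity>)"
    by (rule measurable_oracle_section[OF _ direct_sum_in_class[OF fs]]) simp
  have f: "?o \<in> measurable (point_space \<infinity>) (jet_space p (enat (ds i)))"
    by (rule measurable_compose[OF measurable_block[of _ ds i] measurable_oracle_section[OF dims_enat fs]])
  have "(\<lambda>w. \<lambda>hs\<in>directions p \<infinity>. orc \<infinity> ?F (fst w) hs + lam i * mu i ^ length hs *
      (snd w (map (block ds i) hs) - ?o (fst w) (map (block ds i) hs)))
    \<in> measurable ?M (Pi\<^sub>M (directions p \<infinity>) (\<lambda>_. borel))"
  proof (rule measurable_restrict)
    fix hs assume hs: "hs \<in> directions p \<infinity>"
    have "(\<lambda>w. orc \<infinity> ?F (fst w) hs) \<in> borel_measurable ?M"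
      by (intro measurable_compose[OF measurable_fst measurable_compose[OF F]] measurable_jet_eval hs)
    moreover have "(\<lambda>w. ?o (fst w) (map (block ds i) hs)) \<in> borel_measurable ?M"
      by (intro measurable_compose[OF measurable_fst measurable_compose[OF f]] measurable_jet_eval
          map_block_directions hs)
    moreover have "(\<lambda>w. snd w (map (block ds i) hs)) \<in> borel_measurable ?M"
      by (intro measurable_compose[OF measurable_snd] measurable_jet_eval map_block_directions hs)
    ultimately show "(\<lambda>w. orc \<infinity> ?F (fst w) hs + lam i * mu i ^ length hs *
        (snd w (map (block ds i) hs) - ?o (fst w) (map (block ds i) hs))) \<in> borel_measurable ?M"
      by (intro borel_measurable_add borel_measurable_times borel_measurable_diff borel_measurable_const)
  qed
  moreover have "bounded_multilinear_form \<infinity> k (substitute_answer fs i x T)"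
    if x: "x \<in> space (point_space \<infinity>)" and T: "T \<in> space (jet_space p (enat (ds i)))" and k: "k \<le> p"
    for x T k
  proof (rule bounded_multilinear_form_cong)
    \<comment> \<open>On lists of length k the factor \<open>mu i ^ length hs\<close> is the
      constant \<open>mu i ^ k\<close>, which turns the answer into a linear combination of
      forms.\<close>
    show "bounded_multilinear_form \<infinity> k (\<lambda>hs. orc \<infinity> ?F x hs + lam i * mu i ^ k *
        (T (map (block ds i) hs) + (- 1) * ?o x (map (block ds i) hs)))"
      using measurable_space[OF F x] measurable_space[OF f x] T k
      by (intro bounded_multilinear_form_lincomb bounded_multilinear_form_block)
        (simp_all add: space_jet_space)
    show "substitute_answer fs i x T hs = orc \<infinity> ?F x hs + lam i * mu i ^ k *
        (T (map (block ds i) hs) + (- 1) * ?o x (map (block ds i) hs))"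
      if "set hs \<subseteq> hilb \<infinity>" "length hs = k" for hs
      using that k by (simp add: substitute_answer_def directions_def)
  qed
  ultimately show ?thesis
    unfolding jet_space_def[of p \<infinity>]
    by (intro measurable_restrict_space2)
      (auto simp: space_pair_measure substitute_answer_def case_prod_beta)
qed

end

section \<open>Independent summands\<close>

lemma (in prob_space) prob_all_ge:
  fixes P :: "nat \<Rightarrow> 'a \<Rightarrow> bool"
  assumes meas: "\<And>i. {x \<in> space M. P i x} \<in> events"
    and ge: "\<And>i. 1 - e i \<le> \<P>(x in M. P i x)" and e: "e sums s"
  shows "1 - s \<le> \<P>(x in M. \<forall>i. P i x)"
proof -
  define B where "B i = space M - {x \<in> space M. P i x}" for i
  have B: "B i \<in> events" for i
    unfolding B_def using meas by blast
  have le: "prob (B i) \<le> e i" for i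
    unfolding B_def using prob_compl[OF meas[of i]] ge[of i] by simp
  have sm: "summable (\<lambda>i. prob (B i))"
    by (rule summable_comparison_test'[OF sums_summable[OF e]]) (use le in auto)
  have "prob (\<Union>i. B i) \<le> (\<Sum>i. prob (B i))"
    using B sm by (intro finite_measure_subadditive_countably) auto
  also have "\<dots> \<le> s"
    using suminf_le[OF le sm sums_summable[OF e]] sums_unique[OF e] by simp
  finally have "1 - s \<le> prob (space M - (\<Union>i. B i))"
    using prob_compl[of "\<Union>i. B i"] B by auto
  also have "space M - (\<Union>i. B i) = {x \<in> space M. \<forall>i. P i x}"
    by (auto simp: B_def)
  finally show ?thesis .
qed

lemma measurable_fun_upd_section:
  assumes "X \<in> space (Pi\<^sub>M (UNIV - {i}) M)"
  shows "(\<lambda>w. (fst w, X(i := snd w))) \<in> measurable (U \<Otimes>\<^sub>M M i) (U \<Otimes>\<^sub>M Pi\<^sub>M UNIV M)"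
proof -
  have "(\<lambda>w. X(i := snd w)) \<in> measurable (U \<Otimes>\<^sub>M M i) (Pi\<^sub>M UNIV M)"
    using assms by (intro measurable_fun_upd[where J = "UNIV - {i}"]) auto
  then show ?thesis by (intro measurable_Pair measurable_fst)
qed

text \<open>Fubini with the i-th factor isolated. The bound is available for each choice
  \<open>X\<close> of the other coordinates, so \<open>X\<close> has to be integrated last; the rest
  rearranges the integrals into the product measure.\<close>

lemma prob_pair_PiM_ge:
  assumes U: "prob_space U" and M: "\<And>j. prob_space (M j)"
    and P: "{w \<in> space (U \<Otimes>\<^sub>M Pi\<^sub>M UNIV M). P w} \<in> sets (U \<Otimes>\<^sub>M Pi\<^sub>M UNIV M)" (is "?E \<in> sets ?N")
    and ge: "\<And>X. X \<in> space (Pi\<^sub>M (UNIV - {i}) M) \<Longrightarrow>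
      a \<le> \<P>(w in U \<Otimes>\<^sub>M M i. P (fst w, X(i := snd w)))"
  shows "a \<le> \<P>(w in U \<Otimes>\<^sub>M Pi\<^sub>M UNIV M. P w)"
proof -
  let ?R = "Pi\<^sub>M (UNIV - {i}) M"
  have ins: "insert i (UNIV - {i}) = UNIV" by auto
  interpret U: prob_space U by (rule U)
  interpret Mi: prob_space "M i" by (rule M)
  interpret R: prob_space ?R by (rule prob_space_PiM[OF M])
  interpret F: prob_space "Pi\<^sub>M UNIV M" by (rule prob_space_PiM[OF M])
  interpret MR: pair_prob_space "M i" ?R ..
  interpret UR: pair_prob_space U ?R ..
  interpret UM: pair_prob_space U "M i" ..
  interpret UF: pair_prob_space U "Pi\<^sub>M UNIV M" ..
  have split: "Pi\<^sub>M UNIV M = distr (M i \<Otimes>\<^sub>M ?R) (Pi\<^sub>M UNIV M) (\<lambda>(x, X). X(i := x))"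
    using distr_pair_PiM_eq_PiM[of "UNIV - {i}" M i] M unfolding ins by simp
  have upd: "(\<lambda>(x, X). X(i := x)) \<in> measurable (M i \<Otimes>\<^sub>M ?R) (Pi\<^sub>M UNIV M)"
    unfolding case_prod_beta by (intro measurable_fun_upd[where J = "UNIV - {i}"]) auto
  have E: "(indicator ?E :: _ \<Rightarrow> ennreal) \<in> borel_measurable ?N"
    using P by simp
  define g :: "_ \<Rightarrow> _ \<Rightarrow> _ \<Rightarrow> ennreal" where "g u x X = indicator ?E (u, X(i := x))" for u x X
  have "(\<lambda>w. (fst w, (snd (snd w))(i := fst (snd w)))) \<in> measurable (U \<Otimes>\<^sub>M (M i \<Otimes>\<^sub>M ?R)) ?N"
    by (intro measurable_Pair measurable_fst measurable_fun_upd[where J = "UNIV - {i}"]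
      measurable_compose[OF measurable_snd]) auto
  from measurable_compose[OF this E]
  have g: "(\<lambda>w. g (fst w) (fst (snd w)) (snd (snd w))) \<in> borel_measurable (U \<Otimes>\<^sub>M (M i \<Otimes>\<^sub>M ?R))"
    by (simp add: g_def)
  have g1: "(\<lambda>w. g u (fst w) (snd w)) \<in> borel_measurable (M i \<Otimes>\<^sub>M ?R)" if "u \<in> space U" for u
    using measurable_compose[OF measurable_Pair1'[OF that, of "M i \<Otimes>\<^sub>M ?R"] g] by simp
  \<comment> \<open>The coordinates are reordered so that the variable integrated out comes
    last.\<close>
  have "(\<lambda>w. (fst (fst w), (snd w, snd (fst w)))) \<in> measurable ((U \<Otimes>\<^sub>M ?R) \<Otimes>\<^sub>M M i) (U \<Otimes>\<^sub>M (M i \<Otimes>\<^sub>M ?R))"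
    by measurable
  from measurable_compose[OF this g]
  have "(\<lambda>w. \<integral>\<^sup>+x. g (fst w) x (snd w) \<partial>M i) \<in> borel_measurable (U \<Otimes>\<^sub>M ?R)"
    by (intro Mi.borel_measurable_nn_integral) (simp add: case_prod_beta)
  then have g2: "(\<lambda>(u, X). \<integral>\<^sup>+x. g u x X \<partial>M i) \<in> borel_measurable (U \<Otimes>\<^sub>M ?R)"
    by (simp add: case_prod_beta)
  have inner: "ennreal a \<le> (\<integral>\<^sup>+u. \<integral>\<^sup>+x. g u x X \<partial>M i \<partial>U)" if X: "X \<in> space ?R" for X
  proof -
    let ?S = "{w \<in> space (U \<Otimes>\<^sub>M M i). P (fst w, X(i := snd w))}"
    note m = measurable_fun_upd_section[OF X, of U]
    have "?S = (\<lambda>w. (fst w, X(i := snd w))) -` ?E \<inter> space (U \<Otimes>\<^sub>M M i)"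
      using measurable_space[OF m] by auto
    then have S: "?S \<in> sets (U \<Otimes>\<^sub>M M i)"
      using measurable_sets[OF m P] by simp
    have "(\<integral>\<^sup>+u. \<integral>\<^sup>+x. g u x X \<partial>M i \<partial>U) = (\<integral>\<^sup>+u. \<integral>\<^sup>+x. indicator ?S (u, x) \<partial>M i \<partial>U)"
      using measurable_space[OF m]
      by (intro nn_integral_cong) (auto simp: g_def space_pair_measure indicator_def)
    also have "\<dots> = emeasure (U \<Otimes>\<^sub>M M i) ?S"
      using S by (subst Mi.nn_integral_fst) auto
    finally show ?thesis
      using ge[OF X] by (simp add: UM.emeasure_eq_measure ennreal_leI)
  qed
  have "ennreal a = (\<integral>\<^sup>+X. ennreal a \<partial>?R)"
    by (simp add: R.emeasure_space_1)
  also have "\<dots> \<le> (\<integral>\<^sup>+X. \<integral>\<^sup>+u. \<integral>\<^sup>+x. g u x X \<partial>M i \<partial>U \<partial>?R)"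
    by (intro nn_integral_mono inner)
  \<comment> \<open>After this swap the integrals over x and \<open>X\<close> are adjacent and
    recombine into the full product by \<open>split\<close>.\<close>
  also have "\<dots> = (\<integral>\<^sup>+u. \<integral>\<^sup>+X. \<integral>\<^sup>+x. g u x X \<partial>M i \<partial>?R \<partial>U)"
    by (rule UR.Fubini'[OF g2])
  also have "\<dots> = (\<integral>\<^sup>+u. \<integral>\<^sup>+F. indicator ?E (u, F) \<partial>Pi\<^sub>M UNIV M \<partial>U)"
  proof (rule nn_integral_cong)
    fix u assume u: "u \<in> space U"
    have "(\<integral>\<^sup>+F. indicator ?E (u, F) \<partial>Pi\<^sub>M UNIV M)
        = (\<integral>\<^sup>+F. indicator ?E (u, F) \<partial>distr (M i \<Otimes>\<^sub>M ?R) (Pi\<^sub>M UNIV M) (\<lambda>(x, X). X(i := x)))"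
      by (subst split) (rule refl)
    also have "\<dots> = (\<integral>\<^sup>+w. g u (fst w) (snd w) \<partial>(M i \<Otimes>\<^sub>M ?R))"
      unfolding g_def
      using measurable_compose[OF measurable_Pair1'[OF u] E]
      by (subst nn_integral_distr[OF upd]) (simp_all add: case_prod_beta)
    also have "\<dots> = (\<integral>\<^sup>+X. \<integral>\<^sup>+x. g u x X \<partial>M i \<partial>?R)"
      using MR.nn_integral_snd[OF g1[OF u]] by simp
    finally show "(\<integral>\<^sup>+X. \<integral>\<^sup>+x. g u x X \<partial>M i \<partial>?R) = (\<integral>\<^sup>+F. indicator ?E (u, F) \<partial>Pi\<^sub>M UNIV M)"
      by simp
  qed
  also have "\<dots> = emeasure ?N ?E"
    using P by (subst F.nn_integral_fst[OF E]) auto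
  finally show ?thesis
    by (simp add: UF.emeasure_eq_measure)
qed

lemma prob_space_unif01: "prob_space unif01"
  by (rule prob_spaceI) (simp add: unif01_def space_restrict_space emeasure_restrict_space)

section \<open>The random direct sum and its lower bound\<close>

context direct_sum_dims
begin

lemma measurable_direct_sum:
  assumes D: "\<And>i. random_function (enat (ds i)) (Fc (enat (ds i))) (D i)"
  shows "direct_sum lam mu ds \<in> measurable (Pi\<^sub>M UNIV D) (fun_space \<infinity> (Fc \<infinity>))"
proof -
  have sets_D: "sets (D i) = sets (fun_space (enat (ds i)) (Fc (enat (ds i))))" for i
    using D by (simp add: random_function_def)
  have space_D: "space (D i) = Fc (enat (ds i))" for i
    using sets_eq_imp_space_eq[OF sets_D] space_fun_space[OF dims_enat] by simp
  have "direct_sum lam mu ds fs \<in> Fc \<infinity>" if "fs \<in> space (Pi\<^sub>M UNIV D)" for fs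
    using that by (intro direct_sum_in_class) (auto simp: space_PiM space_D)
  moreover have "(\<lambda>fs. direct_sum lam mu ds fs x) \<in> borel_measurable (Pi\<^sub>M UNIV D)" for x
    unfolding direct_sum_def
  proof (intro borel_measurable_suminf borel_measurable_times borel_measurable_const)
    fix i
    have "(\<lambda>f. f (mu i *\<^sub>R block ds i x)) \<in> borel_measurable (fun_space (enat (ds i)) (Fc (enat (ds i))))"
      unfolding fun_space_def
      by (intro measurable_restrict_space1 measurable_component_singleton hilb_scaleR block_in_hilb)
    then have "(\<lambda>f. f (mu i *\<^sub>R block ds i x)) \<in> borel_measurable (D i)"
      by (simp add: measurable_cong_sets[OF sets_D refl])
    then show "(\<lambda>fs. fs i (mu i *\<^sub>R block ds i x)) \<in> borel_measurable (Pi\<^sub>M UNIV D)"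
      by (intro measurable_compose[OF measurable_component_singleton]) auto
  qed
  ultimately show ?thesis
    unfolding fun_space_def
    by (intro measurable_restrict_space2 measurable_PiM_single') (auto simp: hilb_infinity)
qed

text \<open>All summands but the \<open>i\<close>-th are fixed; against the remaining one, an algorithm for the
  direct sum can be run within dimension \<open>ds i\<close>.\<close>

lemma direct_sum_lower_bound:
  assumes D: "\<And>i. random_function (enat (ds i)) (Fc (enat (ds i))) (D i)"
    and A: "rand_algorithm p \<infinity> A" and t: "1 \<le> t"
    and bound: "\<And>A'. rand_algorithm p (enat (ds i)) A' \<Longrightarrow>
      a \<le> \<P>((xi, f) in unif01 \<Otimes>\<^sub>M D i. eps (enat (ds i)) (iterate A' (orc (enat (ds i)) f) xi t) f \<ge> c)"
    and b: "b \<le> lam i * mu i ^ q * c"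
  shows "a \<le> \<P>(w in unif01 \<Otimes>\<^sub>M Pi\<^sub>M UNIV D.
      eps \<infinity> (iterate A (orc \<infinity> (direct_sum lam mu ds (snd w))) (fst w) t)
        (direct_sum lam mu ds (snd w)) \<ge> b)" (is "a \<le> \<P>(w in ?N. ?P w)")
    and "{w \<in> space (unif01 \<Otimes>\<^sub>M Pi\<^sub>M UNIV D).
      eps \<infinity> (iterate A (orc \<infinity> (direct_sum lam mu ds (snd w))) (fst w) t)
        (direct_sum lam mu ds (snd w)) \<ge> b} \<in> sets (unif01 \<Otimes>\<^sub>M Pi\<^sub>M UNIV D)"
proof -
  have sets_D: "sets (D i) = sets (fun_space (enat (ds i)) (Fc (enat (ds i))))"
    and prob_D: "prob_space (D i)" for i
    using D by (auto simp: random_function_def)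
  have space_D: "space (D i) = Fc (enat (ds i))" for i
    using sets_eq_imp_space_eq[OF sets_D] space_fun_space[OF dims_enat] by simp
  have "(\<lambda>w. (fst w, direct_sum lam mu ds (snd w))) \<in> measurable ?N (unif01 \<Otimes>\<^sub>M fun_space \<infinity> (Fc \<infinity>))"
    by (intro measurable_Pair measurable_fst measurable_compose[OF measurable_snd]
      measurable_direct_sum D)
  from measurable_compose[OF this measurable_iterate_error[OF _ A t]]
  have "(\<lambda>w. eps \<infinity> (iterate A (orc \<infinity> (direct_sum lam mu ds (snd w))) (fst w) t)
      (direct_sum lam mu ds (snd w))) \<in> borel_measurable ?N"
    by simp
  then show meas: "{w \<in> space ?N. ?P w} \<in> sets ?N"
    by (rule borel_measurable_le[OF borel_measurable_const])
  show "a \<le> \<P>(w in ?N. ?P w)"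
  proof (rule prob_pair_PiM_ge[OF prob_space_unif01 prob_D meas, where i = i])
    fix X assume X: "X \<in> space (Pi\<^sub>M (UNIV - {i}) D)"
    \<comment> \<open>A filler for the missing i-th summand, available because a probability space
      is nonempty. The reduced algorithm is built from the filler alone and never from the unknown
      f; the filler's contribution cancels in \<open>substitute_answer\<close>.\<close>
    obtain f0 where f0: "f0 \<in> Fc (enat (ds i))"
      using prob_space.not_empty[OF prob_D[of i]] space_D[of i] by auto
    define fs where "fs = X(i := f0)"
    have fs: "fs j \<in> Fc (enat (ds j))" for j
      using X f0 by (auto simp: fs_def space_PiM space_D PiE_iff)
    define A' where "A' = (\<lambda>t w. mu i *\<^sub>R block ds i (replay A (substitute_answer fs i) w t))"
    have "rand_algorithm p (enat (ds i)) A'"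
      unfolding rand_algorithm_def A'_def
      by (intro allI impI measurable_compose[OF measurable_replay[OF A
        measurable_substitute_answer[OF fs]] measurable_block]) auto
    note bound[OF this]
    also have "\<P>((xi, f) in unif01 \<Otimes>\<^sub>M D i.
        eps (enat (ds i)) (iterate A' (orc (enat (ds i)) f) xi t) f \<ge> c)
      \<le> \<P>(w in unif01 \<Otimes>\<^sub>M D i. ?P (fst w, X(i := snd w)))"
    proof (rule finite_measure.finite_measure_mono)
      show "finite_measure (unif01 \<Otimes>\<^sub>M D i)"
        using prob_space_pair[OF prob_space_unif01 prob_D] by (rule prob_space.finite_measure)
      note m = measurable_fun_upd_section[OF X, of unif01]
      have "{w \<in> space (unif01 \<Otimes>\<^sub>M D i). ?P (fst w, X(i := snd w))}
          = (\<lambda>w. (fst w, X(i := snd w))) -` {w \<in> space ?N. ?P w} \<inter> space (unif01 \<Otimes>\<^sub>M D i)"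
        using measurable_space[OF m] by auto
      then show "{w \<in> space (unif01 \<Otimes>\<^sub>M D i). ?P (fst w, X(i := snd w))} \<in> sets (unif01 \<Otimes>\<^sub>M D i)"
        using measurable_sets[OF m meas] by simp
      have "?P (xi, X(i := f))" if f: "f \<in> Fc (enat (ds i))"
        and c: "c \<le> eps (enat (ds i)) (iterate A' (orc (enat (ds i)) f) xi t) f" for xi f
      proof -
        let ?F = "direct_sum lam mu ds (X(i := f))"
        have upd: "X(i := f) = fs(i := f)" by (simp add: fs_def)
        have gs: "(X(i := f)) j \<in> Fc (enat (ds j))" for j
          using fs f by (simp add: upd)
        have sim: "iterate A' (orc (enat (ds i)) f) xi t = mu i *\<^sub>R block ds i (iterate A (orc \<infinity> ?F) xi t)"
          unfolding A'_def upd
          by (rule iterate_replay[where g = "\<lambda>x. mu i *\<^sub>R block ds i x"]) (rule substitute_answer_oracle[OF fs f])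
        have "b \<le> lam i * mu i ^ q * c" by (rule b)
        also have "\<dots> \<le> lam i * mu i ^ q * eps (enat (ds i)) (mu i *\<^sub>R block ds i (iterate A (orc \<infinity> ?F) xi t)) f"
          using c lam_pos[of i] mu_pos[of i] unfolding sim by (intro mult_left_mono) auto
        also have "\<dots> \<le> eps \<infinity> (iterate A (orc \<infinity> ?F) xi t) ?F"
          using error_direct_sum[of "X(i := f)" i, OF gs] by simp
        finally show ?thesis by simp
      qed
      then show "{(xi, f) \<in> space (unif01 \<Otimes>\<^sub>M D i).
            c \<le> eps (enat (ds i)) (iterate A' (orc (enat (ds i)) f) xi t) f}
          \<subseteq> {w \<in> space (unif01 \<Otimes>\<^sub>M D i). ?P (fst w, X(i := snd w))}"
        by (auto simp: space_pair_measure space_D)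
    qed
    finally show "a \<le> \<P>(w in unif01 \<Otimes>\<^sub>M D i. ?P (fst w, X(i := snd w)))" .
  qed
qed

end

section \<open>Choice of the stages and conclusion\<close>

lemma decreasing_bijection_eventually_le:
  assumes r: "decreasing_bijection r" and c: "0 < c"
  shows "\<exists>m\<ge>N. r (real m) \<le> c"
proof -
  \<comment> \<open>Surjectivity onto (0,1] forces arbitrarily small values; the minimum stays in
    that range when c exceeds 1.\<close>
  have "min c 1 \<in> r ` {1..}"
    using r c by (auto simp: decreasing_bijection_def bij_betw_def)
  then obtain y where y: "1 \<le> y" "r y = min c 1" by auto
  define m where "m = max N (nat \<lceil>y\<rceil>)"
  have "y \<le> real (nat \<lceil>y\<rceil>)"
    by (rule real_nat_ceiling_ge)
  also have "\<dots> \<le> real m" by (simp add: m_def)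
  finally have "y \<le> real m" .
  then have "r (real m) \<le> r y"
    using r y(1) by (auto simp: decreasing_bijection_def monotone_on_def)
  then show ?thesis
    using y(2) by (intro exI[of _ m]) (auto simp: m_def)
qed

lemma decreasing_bijection_pos:
  assumes "decreasing_bijection r" "1 \<le> x"
  shows "0 < r x"
  using assms by (auto simp: decreasing_bijection_def dest!: bij_betw_apply[where a = x])

theorem theorem2:
  fixes Fc :: "enat \<Rightarrow> (ell2 \<Rightarrow> real) set"
    and eps :: "enat \<Rightarrow> ell2 \<Rightarrow> (ell2 \<Rightarrow> real) \<Rightarrow> real"
    and orc :: "enat \<Rightarrow> (ell2 \<Rightarrow> real) \<Rightarrow> ell2 \<Rightarrow> ell2 list \<Rightarrow> real"
    and \<beta> \<rho> :: "real \<Rightarrow> real"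
    and lam mu :: "nat \<Rightarrow> real"
    and p q :: nat
  assumes "1 \<le> p"
    and "function_classes Fc"
    and "error_metric Fc eps"
    and "direct_sum_property Fc eps q lam mu"
    and "oracle_well_defined p Fc orc"
    and "selection_respects_sums p Fc orc lam mu"
    and "decreasing_bijection \<beta>"
    and "randomized_lower_bound p Fc eps orc \<beta>"
    and "decreasing_bijection \<rho>"
  shows "\<exists>n :: nat \<Rightarrow> nat. (\<forall>i. 1 \<le> n i) \<and> filterlim n at_top sequentially \<and>
    (\<forall>\<delta>. 0 < \<delta> \<and> \<delta> \<le> 1 / 2 \<longrightarrow>
      (\<exists>D. random_function \<infinity> (Fc \<infinity>) D \<and>
        (\<forall>A. rand_algorithm p \<infinity> A \<longrightarrow>
          \<P>((xi, F) in unif01 \<Otimes>\<^sub>M D.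
            \<forall>i. eps \<infinity> (iterate A (orc \<infinity> F) xi (n i + 1)) F \<ge> \<rho> (real (n i)) * \<beta> (real (n i)))
          \<ge> 1 - 2 * \<delta>)))"
proof -
  interpret direct_sum_classes Fc eps orc lam mu p q
    using assms by unfold_locales auto
  define hard where "hard C m \<delta> d D \<longleftrightarrow> 1 \<le> d \<and> random_function (enat d) (Fc (enat d)) D \<and>
      (\<forall>A. rand_algorithm p (enat d) A \<longrightarrow>
        \<P>((xi, f) in unif01 \<Otimes>\<^sub>M D.
          eps (enat d) (iterate A (orc (enat d) f) xi (m + 1)) f \<ge> C * \<beta> (real m))
        \<ge> 1 - 2 * \<delta>)" for C m \<delta> d D
  have "\<exists>C>0. \<forall>m\<ge>1. \<forall>\<delta>. 0 < \<delta> \<and> \<delta> \<le> 1 / 2 \<longrightarrow> (\<exists>d D. hard C m \<delta> d D)"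
    using assms(8) unfolding randomized_lower_bound_def hard_def by (simp only: ex_simps)
  then obtain C where C: "0 < C"
    and ex_hard: "\<And>m \<delta>. 1 \<le> m \<Longrightarrow> 0 < \<delta> \<Longrightarrow> \<delta> \<le> 1 / 2 \<Longrightarrow> \<exists>d D. hard C m \<delta> d D"
    by blast
  \<comment> \<open>Only \<open>C\<close>, \<rho> and the direct-sum constants enter here, so the
    stages do not depend on \<delta>. The bound \<open>Suc i\<close> yields both positivity and
    divergence.\<close>
  have "\<forall>i. \<exists>m\<ge>Suc i. \<rho> (real m) \<le> lam i * mu i ^ q * C"
    using decreasing_bijection_eventually_le[OF assms(9)] lam_pos mu_pos C by simp
  then obtain n where n: "\<And>i. Suc i \<le> n i" and \<rho>: "\<And>i. \<rho> (real (n i)) \<le> lam i * mu i ^ q * C"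
    by metis
  have n1: "1 \<le> n i" for i using n[of i] by simp
  have threshold: "\<rho> (real (n i)) * \<beta> (real (n i)) \<le> lam i * mu i ^ q * (C * \<beta> (real (n i)))" for i
    using mult_right_mono[OF \<rho>[of i], of "\<beta> (real (n i))"]
      decreasing_bijection_pos[OF assms(7), of "real (n i)"] n1[of i]
    by (simp add: mult.assoc)
  have "filterlim n at_top sequentially"
    unfolding filterlim_at_top eventually_sequentially using n Suc_leD order_trans by metis
  moreover have "\<exists>D. random_function \<infinity> (Fc \<infinity>) D \<and> (\<forall>A. rand_algorithm p \<infinity> A \<longrightarrow>
      \<P>((xi, F) in unif01 \<Otimes>\<^sub>M D.
        \<forall>i. eps \<infinity> (iterate A (orc \<infinity> F) xi (n i + 1)) F \<ge> \<rho> (real (n i)) * \<beta> (real (n i)))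
      \<ge> 1 - 2 * \<delta>)" if \<delta>: "0 < \<delta>" "\<delta> \<le> 1 / 2" for \<delta>
  proof -
    \<comment> \<open>With exponent \<open>Suc i\<close> the weights sum to 1, so the failure bounds
      \<open>2 * \<delta>' i\<close> add up to exactly \<open>2 * \<delta>\<close>.\<close>
    define \<delta>' where "\<delta>' i = \<delta> * (1 / 2) ^ Suc i" for i
    have "(1 / 2 :: real) ^ Suc i \<le> 1" for i
      by (intro power_le_one) auto
    then have "\<delta>' i \<le> \<delta>" for i
      using \<delta>(1) by (simp add: \<delta>'_def mult_left_le)
    then have \<delta>': "0 < \<delta>' i" "\<delta>' i \<le> 1 / 2" for i
      using \<delta> order_trans[of "\<delta>' i" \<delta> "1 / 2"] by (auto simp: \<delta>'_def)
    have "\<forall>i. \<exists>d D. hard C (n i) (\<delta>' i) d D"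
      using ex_hard n1 \<delta>' by blast
    then obtain ds D where hard_D: "\<And>i. hard C (n i) (\<delta>' i) (ds i) (D i)"
      by metis
    then have ds: "\<And>i. 1 \<le> ds i" and D: "\<And>i. random_function (enat (ds i)) (Fc (enat (ds i))) (D i)"
      by (simp_all add: hard_def)
    interpret direct_sum_dims Fc eps orc lam mu p q ds
      by unfold_locales (rule ds)
    let ?P = "Pi\<^sub>M UNIV D" and ?N = "fun_space \<infinity> (Fc \<infinity>)" and ?G = "direct_sum lam mu ds"
    have G: "?G \<in> measurable ?P ?N"
      by (rule measurable_direct_sum[OF D])
    have prob_P: "prob_space ?P"
      using D by (intro prob_space_PiM) (simp add: random_function_def)
    have "random_function \<infinity> (Fc \<infinity>) (distr ?P ?N ?G)"
      using prob_space.prob_space_distr[OF prob_P G] by (simp add: random_function_def)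
    moreover have "1 - 2 * \<delta> \<le> \<P>((xi, F) in unif01 \<Otimes>\<^sub>M distr ?P ?N ?G.
        \<forall>i. eps \<infinity> (iterate A (orc \<infinity> F) xi (n i + 1)) F \<ge> \<rho> (real (n i)) * \<beta> (real (n i)))"
      if A: "rand_algorithm p \<infinity> A" for A
    proof -
      let ?good = "\<lambda>i (xi, F). eps \<infinity> (iterate A (orc \<infinity> F) xi (n i + 1)) F \<ge> \<rho> (real (n i)) * \<beta> (real (n i))"
      let ?T = "\<lambda>(xi, fs). (xi, ?G fs)"
      have "prob_space (distr ?P ?N ?G)"
        by (rule prob_space.prob_space_distr[OF prob_P G])
      \<comment> \<open>Writing the seed's law as its image under the identity turns the joint law
        of seed and direct sum into an image of the joint law of seed and summands, where the stage
        bounds hold.\<close>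
      then have "distr unif01 unif01 (\<lambda>xi. xi) \<Otimes>\<^sub>M distr ?P ?N ?G
          = distr (unif01 \<Otimes>\<^sub>M ?P) (unif01 \<Otimes>\<^sub>M ?N) ?T"
        by (intro pair_measure_distr G measurable_ident_sets[OF refl] prob_space_imp_sigma_finite)
      then have eq: "unif01 \<Otimes>\<^sub>M distr ?P ?N ?G = distr (unif01 \<Otimes>\<^sub>M ?P) (unif01 \<Otimes>\<^sub>M ?N) ?T"
        by (simp add: distr_id)
      have T: "?T \<in> measurable (unif01 \<Otimes>\<^sub>M ?P) (unif01 \<Otimes>\<^sub>M ?N)"
        unfolding case_prod_beta
        by (intro measurable_Pair measurable_fst measurable_compose[OF measurable_snd G])
      have meas: "{w \<in> space (unif01 \<Otimes>\<^sub>M ?N). ?good i w} \<in> sets (unif01 \<Otimes>\<^sub>M ?N)" for i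
        unfolding case_prod_beta
        by (intro borel_measurable_le[OF borel_measurable_const] measurable_iterate_error[OF _ A]) auto
      have "(\<lambda>i. 2 * \<delta> * (1 / 2) ^ Suc i) sums (2 * \<delta> * 1)"
        by (intro sums_mult power_half_series)
      then have sums: "(\<lambda>i. 2 * \<delta>' i) sums (2 * \<delta>)"
        by (simp add: \<delta>'_def mult.assoc)
      interpret UP: prob_space "unif01 \<Otimes>\<^sub>M ?P"
        by (rule prob_space_pair[OF prob_space_unif01 prob_P])
      have "1 - 2 * \<delta> \<le> \<P>(w in unif01 \<Otimes>\<^sub>M ?P. \<forall>i. ?good i (?T w))"
        using direct_sum_lower_bound[OF D A _ hard_D[unfolded hard_def, THEN conjunct2, THEN conjunct2, rule_format] threshold] sums
        by (intro UP.prob_all_ge[where e = "\<lambda>i. 2 * \<delta>' i"]) (simp_all add: case_prod_beta)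
      also have "\<dots> = measure (distr (unif01 \<Otimes>\<^sub>M ?P) (unif01 \<Otimes>\<^sub>M ?N) ?T)
          {w \<in> space (unif01 \<Otimes>\<^sub>M ?N). \<forall>i. ?good i w}"
        using measurable_space[OF T]
        by (subst measure_distr[OF T sets.sets_Collect_countable_All[OF meas]])
          (auto intro!: arg_cong[where f = "measure (unif01 \<Otimes>\<^sub>M ?P)"])
      also have "{w \<in> space (unif01 \<Otimes>\<^sub>M ?N). \<forall>i. ?good i w}
          = {(xi, F) \<in> space (unif01 \<Otimes>\<^sub>M distr ?P ?N ?G).
              \<forall>i. eps \<infinity> (iterate A (orc \<infinity> F) xi (n i + 1)) F \<ge> \<rho> (real (n i)) * \<beta> (real (n i))}"
        by (auto simp: space_pair_measure)
      finally show ?thesis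
        unfolding eq[symmetric] by (simp add: case_prod_beta)
    qed
    ultimately show ?thesis by blast
  qed
  ultimately show ?thesis
    using n1 by blast
qed

end
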